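(* Let $k$ be an even integer with either $(n,p)=(3,2)$, $k\ge4$, or $(n,p)=(5,4)$, $k\ge6$. Put $\lambda^2=\frac{k(k+n-1)}{p}$ and $\varphi_0=\sqrt{\frac{p-n\lambda^{-2}}{n-p}}$. Then there exist a smooth solution $t\in\mathbb R\mapsto(\varphi(t),\psi(t))$ of the system $$\begin{cases}\varphi_t=\psi,\\ \psi_t=-\psi-\Big[\big(n-p+\frac{p}{1+\lambda^2\varphi^2}\big)\psi+\big(n-p+\frac{(1-\lambda^2)p}{1+\lambda^2\varphi^2}\big)\varphi\Big]\big[1+(\varphi+\psi)^2\big],\end{cases}$$ and a strictly increasing sequence $\{T_i:i\in\mathbb Z^+\}$ in $\mathbb R$ such that: - $\lim_{t\to-\infty}(\varphi(t),\psi(t))=(0,0)$; - $\varphi(t)=O(e^{(k-1)t})$ and $\psi(t)=O(e^{(k-1)t})$ as $t\to-\infty$; - $\lim_{t\to+\infty}(\varphi(t),\psi(t))=(\varphi_0,0)$; - $\lim_{i\to\infty}T_i=+\infty$; - $\psi(T_i)=0$ for all $i\in\mathbb Z^+$; - with $\varphi_i:=\varphi(T_i)$, the sequence $\{\varphi_{2m-1}:m\in\mathbb Z^+\}$ is strictly decreasing and the sequence $\{\varphi_{2m}:m\in\mathbb Z^+\}$ is strictly increasing, with common limit $\varphi_0$; - $\psi(t)>0$ for $t\in(-\infty,T_1)\cup\bigcup_{m\in\mathbb Z^+}(T_{2m},T_{2m+1})$; - $\psi(t)<0$ for $t\in\bigcup_{m\in\mathbb Z^+}(T_{2m-1},T_{2m})$;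 - $(\varphi+\psi)(t)>0$ for all $t\in\mathbb R$.
   Context: $\mathbb Z^+$ denotes the positive integers. Subscript $t$ denotes the derivative in $t$. *)

theory Defs
  imports "HOL-Analysis.Analysis" "HOL-Library.Landau_Symbols"
begin

(* vector_derivative is total, so differentiability is demanded of every iterated
   derivative f, f', f'', ... at every point. *)
definition smooth_curve :: "(real \<Rightarrow> 'a::real_normed_vector) \<Rightarrow> bool" where
  "smooth_curve f \<longleftrightarrow>
     (\<forall>m t. ((\<lambda>g s. vector_derivative g (at s)) ^^ m) f differentiable (at t))"

end

theory Submission
  imports Defs
begin

text \<open>
  Write \<open>w = \<phi> + \<psi>\<close>, \<open>\<mu> = \<lambda>\<^sup>2\<close> and note \<open>n = p + 1\<close>, \<open>p \<mu> = k (k + p)\<close>. The origin is a saddle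
  with eigenvalues \<open>k - 1\<close> and \<open>- (k + p + 1)\<close>. In the variable \<open>r = exp t\<close>, put
  \<open>\<phi> = r\<^bsup>k-1\<^esup> (A + B)\<close> and \<open>w = r\<^bsup>k-1\<^esup> (k A - (k + p) B)\<close>; variation of constants then turns
  the unstable orbit into a Volterra equation starting at \<open>r = 0\<close>, which is solved globally by a weighted
  contraction once the nonlinearity is truncated. First-exit arguments give \<open>0 < \<phi>, w < p \<mu>\<close>, so the
  truncation is never active.

  The system is the minimal surface equation of a cone, and the scale-invariant density
  \<open>(1 + \<phi> w) (1 + \<mu> \<phi>\<^sup>2)\<^bsup>p/2\<^esup> / (sqrt (1 + w\<^sup>2) (1 + \<phi>\<^sup>2)\<^bsup>p/2+1\<^esup>)\<close> from the monotonicity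
  formula increases along orbits, strictly where \<open>\<psi> \<noteq> 0\<close>. Its dissipation forces convergence to
  \<open>(\<phi>\<^sub>0, 0)\<close>. The discriminant of the linearisation there is negative, so \<open>\<psi>\<close> has infinitely many
  zeros; at each of them the density depends on \<open>\<phi>\<close> alone, with maximum at \<open>\<phi>\<^sub>0\<close>, which orders the
  turning points on either side.
\<close>

section \<open>A singular Volterra equation on the half line\<close>

text \<open>The integral equation replaces both an unstable manifold theorem and a continuation
  argument: it lives on the whole half line r >= 0, so the orbit exists for all t at once, with its
  rate at -infinity built in. The price is a Lipschitz constant uniform in r, although variation of
  constants brings in a factor r^(-k). The remainder at the saddle is cubic, so cutting its
  arguments off at height m = const min(1, r) leaves m^2 r^(k-1) / r^k, which is at most a constant
  times min(r, 1/r). Such a cutoff is compatible with the orbit because r^(k-1) <= r for r <= 1. The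
  density alone controls only the velocity; the limit of \<phi> needs an additional cross term. The
  bounds on k are arithmetic: with b = k (k + p), non-real eigenvalues at the equilibrium mean (p +
  2)^2 b < 8 (p + 1) (b - p - 1), that is, b > 9 for p = 2 and b > 50 for p = 4.\<close>

lemma integral_exp_bound:
  fixes u :: "real \<Rightarrow> real"
  assumes "continuous_on {0..r} u" and "\<And>s. 0 \<le> s \<Longrightarrow> s \<le> r \<Longrightarrow> \<bar>u s\<bar> \<le> C * exp (L * s)"
    and "L > 0" and "r \<ge> 0"
  shows "\<bar>integral {0..r} u\<bar> \<le> C / L * exp (L * r)"
proof -
  have C: "C \<ge> 0" using assms(2)[of 0] assms(4) by auto
  have I: "((\<lambda>s. C * exp (L * s)) has_integral (C / L * exp (L * r) - C / L * exp (L * 0))) {0..r}"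
    by (rule fundamental_theorem_of_calculus)
      (use assms in \<open>auto intro!: derivative_eq_intros simp: has_real_derivative_iff_has_vector_derivative[symmetric]\<close>)
  have "norm (integral {0..r} u) \<le> integral {0..r} (\<lambda>s. C * exp (L * s))"
    by (rule integral_norm_bound_integral)
      (use assms I in \<open>auto intro: integrable_continuous_real\<close>)
  also have "\<dots> = C / L * exp (L * r) - C / L" by (subst integral_unique[OF I]) simp
  also have "\<dots> \<le> C / L * exp (L * r)" using C assms(3) by simp
  finally show ?thesis by simp
qed

text \<open>The solution of y' = u - c y / r that vanishes at 0. With (s / r)^c inside the integral
  the kernel is visibly at most 1, uniformly in r and c; the form in
  \<open>weighted_primitive_eq\<close> is the one to differentiate.\<close>

definition weighted_primitive :: "nat \<Rightarrow> (real \<Rightarrow> real) \<Rightarrow> real \<Rightarrow> real" where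
  "weighted_primitive c u r = integral {0..r} (\<lambda>s. (s / r) ^ c * u s)"

lemma weighted_primitive_at_0 [simp]: "weighted_primitive c u 0 = 0"
  by (simp add: weighted_primitive_def)

lemma weighted_primitive_bound:
  assumes u: "continuous_on {0..} u" and b: "\<And>s. 0 \<le> s \<Longrightarrow> \<bar>u s\<bar> \<le> C * exp (L * s)"
    and "L > 0" and "r \<ge> 0"
  shows "\<bar>weighted_primitive c u r\<bar> \<le> C / L * exp (L * r)"
  unfolding weighted_primitive_def
proof (rule integral_exp_bound)
  have "continuous_on {0..r} u" by (rule continuous_on_subset[OF u]) auto
  then show "continuous_on {0..r} (\<lambda>s. (s / r) ^ c * u s)"
    unfolding divide_inverse by (intro continuous_intros)
  fix s assume s: "0 \<le> s" "s \<le> r"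
  have "\<bar>(s / r) ^ c * u s\<bar> = (s / r) ^ c * \<bar>u s\<bar>"
    using s by (simp add: abs_mult)
  also have "\<dots> \<le> 1 * \<bar>u s\<bar>"
    by (intro mult_right_mono power_le_one) (use s in \<open>auto simp: divide_le_eq_1\<close>)
  finally show "\<bar>(s / r) ^ c * u s\<bar> \<le> C * exp (L * s)" using b[OF s(1)] by simp
qed (use assms in auto)

lemma weighted_primitive_eq:
  "weighted_primitive c u r = integral {0..r} (\<lambda>s. s ^ c * u s) / r ^ c"
proof -
  have "integral {0..r} (\<lambda>s. (s / r) ^ c * u s) = integral {0..r} (\<lambda>s. inverse (r ^ c) * (s ^ c * u s))"
    by (simp add: power_divide divide_inverse power_inverse algebra_simps)
  then show ?thesis unfolding weighted_primitive_def
    by (simp add: divide_inverse)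
qed

lemma integral_has_real_derivative_half_line:
  fixes u :: "real \<Rightarrow> real"
  assumes "continuous_on {0..} u" and "r > 0"
  shows "((\<lambda>r. integral {0..r} u) has_real_derivative u r) (at r)"
proof -
  have "((\<lambda>r. integral {0..r} u) has_real_derivative u r) (at r within {0..r + 1})"
    by (rule integral_has_real_derivative)
      (use assms in \<open>auto intro: continuous_on_subset\<close>)
  moreover have "at r within {0..r + 1} = at r"
    by (rule at_within_interior) (use assms in auto)
  ultimately show ?thesis by simp
qed

lemma weighted_primitive_deriv:
  assumes u: "continuous_on {0..} u" and r: "r > 0"
  shows "(weighted_primitive c u has_real_derivative u r - real c * weighted_primitive c u r / r) (at r)"
proof -
  have D: "((\<lambda>r. integral {0..r} (\<lambda>s. s ^ c * u s)) has_real_derivative r ^ c * u r) (at r)"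
    by (rule integral_has_real_derivative_half_line[where u = "\<lambda>s. s ^ c * u s"]) (use assms in \<open>auto intro!: continuous_intros\<close>)
  have "((\<lambda>r. integral {0..r} (\<lambda>s. s ^ c * u s) / r ^ c) has_real_derivative
      u r - real c * weighted_primitive c u r / r) (at r)"
  proof (rule DERIV_cong[OF DERIV_divide[OF D DERIV_pow]])
    show "r ^ c \<noteq> 0" using r by simp
    show "(r ^ c * u r * r ^ c - integral {0..r} (\<lambda>s. s ^ c * u s) * (real c * r ^ (c - Suc 0))) / (r ^ c * r ^ c)
        = u r - real c * weighted_primitive c u r / r"
      using r by (cases c) (auto simp: weighted_primitive_eq field_simps)
  qed
  then show ?thesis by (simp add: weighted_primitive_eq[abs_def])
qed

lemma weighted_primitive_continuous:
  assumes u: "continuous_on {0..} u" and b: "\<And>s. 0 \<le> s \<Longrightarrow> \<bar>u s\<bar> \<le> C * exp (L * s)" and L: "L > 0"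
  shows "continuous_on {0..} (weighted_primitive c u)"
  unfolding continuous_on_eq_continuous_within
proof safe
  fix r :: real assume "r \<ge> 0"
  show "continuous (at r within {0..}) (weighted_primitive c u)"
  proof (cases "r > 0")
    case True
    then show ?thesis
      using weighted_primitive_deriv[OF u True] DERIV_isCont continuous_at_imp_continuous_within by blast
  next
    case False
    with \<open>r \<ge> 0\<close> have [simp]: "r = 0" by simp
    have C: "C \<ge> 0" using b[of 0] by auto
    \<comment> \<open>At the endpoint the derivative formula divides by zero; the kernel bound gives
      decay of order s instead.\<close>
    have bd: "\<bar>weighted_primitive c u s\<bar> \<le> s * (C * exp (L * s))" if "s \<ge> 0" for s
    proof -
      have "norm (integral {0..s} (\<lambda>x. (x / s) ^ c * u x)) \<le> C * exp (L * s) * (s - 0)"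
      proof (rule integral_bound)
        have "continuous_on {0..s} u" by (rule continuous_on_subset[OF u]) auto
        then show "continuous_on {0..s} (\<lambda>x. (x / s) ^ c * u x)"
          unfolding divide_inverse by (intro continuous_intros)
        fix x assume x: "x \<in> {0..s}"
        have "\<bar>(x / s) ^ c * u x\<bar> = (x / s) ^ c * \<bar>u x\<bar>" using x by (simp add: abs_mult)
        also have "\<dots> \<le> 1 * \<bar>u x\<bar>"
          by (intro mult_right_mono power_le_one) (use x in \<open>auto simp: divide_le_eq_1\<close>)
        also have "\<dots> \<le> C * exp (L * x)" using b[of x] x by simp
        also have "\<dots> \<le> C * exp (L * s)" using C L x by (intro mult_left_mono) auto
        finally show "norm ((x / s) ^ c * u x) \<le> C * exp (L * s)" by simp
      qed (use that in auto)
      then show ?thesis by (simp add: weighted_primitive_def mult_ac)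
    qed
    have "(weighted_primitive c u \<longlongrightarrow> 0) (at 0 within {0..})"
    proof (rule Lim_null_comparison)
      show "\<forall>\<^sub>F s in at 0 within {0..}. norm (weighted_primitive c u s) \<le> s * (C * exp (L * s))"
        using bd by (auto simp: eventually_at_filter)
      have "((\<lambda>s. s * (C * exp (L * s))) \<longlongrightarrow> 0 * (C * exp (L * 0))) (at 0 within {0..})"
        by (intro tendsto_intros)
      then show "((\<lambda>s. s * (C * exp (L * s))) \<longlongrightarrow> 0) (at 0 within {0..})" by simp
    qed
    then show ?thesis by (simp add: continuous_within)
  qed
qed

lemma weighted_primitive_diff:
  assumes "continuous_on {0..} u" "continuous_on {0..} v"
  shows "weighted_primitive c u r - weighted_primitive c v r = weighted_primitive c (\<lambda>s. u s - v s) r"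
proof -
  have "(\<lambda>s. (s / r) ^ c * w s) integrable_on {0..r}" if "continuous_on {0..} w" for w :: "real \<Rightarrow> real"
  proof (rule integrable_continuous_real)
    have "continuous_on {0..r} w" by (rule continuous_on_subset[OF that]) auto
    then show "continuous_on {0..r} (\<lambda>x. (x / r) ^ c * w x)"
      unfolding divide_inverse by (intro continuous_intros)
  qed
  from this[OF assms(1)] this[OF assms(2)] show ?thesis
    unfolding weighted_primitive_def by (simp add: right_diff_distrib integral_diff)
qed

text \<open>The weight \<open>exp (- 4 * K * r)\<close> turns the integral operator into a contraction on the whole
  half line.\<close>
lemma singular_volterra_solution:
  fixes f :: "real \<Rightarrow> real \<Rightarrow> real \<Rightarrow> real"
  assumes cont: "\<And>A B. continuous_on {0..} A \<Longrightarrow> continuous_on {0..} B \<Longrightarrow>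
      continuous_on {0..} (\<lambda>r. f r (A r) (B r))"
    and lip: "\<And>r A B A' B'. r \<ge> 0 \<Longrightarrow> \<bar>f r A B - f r A' B'\<bar> \<le> K * (\<bar>A - A'\<bar> + \<bar>B - B'\<bar>)"
    and zero: "\<And>r. f r 0 0 = 0" and K: "K > 0" and xi: "\<xi> \<ge> 0"
  obtains u where "continuous_on {0..} u"
    and "\<And>r. r \<ge> 0 \<Longrightarrow> u r = f r (\<xi> + weighted_primitive 0 u r) (- weighted_primitive c u r)"
    and "\<And>r. r \<ge> 0 \<Longrightarrow> \<bar>u r\<bar> \<le> 2 * K * \<xi> * exp (4 * K * r)"
proof -
  \<comment> \<open>Each of the two primitives gains a factor 1 / L in the weighted norm, so the
    operator has Lipschitz constant 2 K / L = 1/2.\<close>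
  define L where "L = 4 * K"
  have L: "L > 0" using K by (simp add: L_def)
  \<comment> \<open>Bounded continuous functions are total on the reals; \<open>max 0\<close>
    discards the negative half line, and the exponential undoes the weight.\<close>
  define U where "U v s = exp (L * s) * apply_bcontfun v (max 0 s)" for v :: "real \<Rightarrow>\<^sub>C real" and s
  define F where "F w r = f r (\<xi> + weighted_primitive 0 w r) (- weighted_primitive c w r)" for w r
  define P where "P v = Bcontfun (\<lambda>r. exp (- L * max 0 r) * F (U v) (max 0 r))" for v
  have Ucont: "continuous_on {0..} (U v)" for v
    unfolding U_def by (intro continuous_intros continuous_on_compose2[OF continuous_on_apply_bcontfun]) auto
  have Ub: "\<bar>U v s\<bar> \<le> norm v * exp (L * s)" for v s
    unfolding U_def using Bounded_Continuous_Function.norm_bounded[of v "max 0 s"] by (simp add: abs_mult)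
  have Fcont: "continuous_on {0..} (F (U v))" for v
    unfolding F_def
    by (intro cont continuous_intros weighted_primitive_continuous[OF Ucont Ub L])
  have Fb: "\<bar>F (U v) r\<bar> \<le> K * (\<xi> + 2 * (norm v / L * exp (L * r)))" if "r \<ge> 0" for v r
  proof -
    have "\<bar>F (U v) r\<bar> \<le> K * (\<bar>\<xi> + weighted_primitive 0 (U v) r\<bar> + \<bar>weighted_primitive c (U v) r\<bar>)"
      using lip[OF that, of "\<xi> + weighted_primitive 0 (U v) r" "- weighted_primitive c (U v) r" 0 0] zero[of r]
      by (simp add: F_def)
    also have "\<dots> \<le> K * (\<xi> + 2 * (norm v / L * exp (L * r)))"
      using weighted_primitive_bound[OF Ucont[of v] Ub[of v] L that, of 0] xi
        weighted_primitive_bound[OF Ucont[of v] Ub[of v] L that, of c] K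
      by (intro mult_left_mono) linarith+
    finally show ?thesis .
  qed
  have Pv: "apply_bcontfun (P v) r = exp (- L * max 0 r) * F (U v) (max 0 r)" for v r
  proof -
    have "(\<lambda>r. exp (- L * max 0 r) * F (U v) (max 0 r)) \<in> bcontfun"
    proof (rule bcontfun_normI[where b = "K * (\<xi> + 2 * (norm v / L))"])
      show "continuous_on UNIV (\<lambda>r. exp (- L * max 0 r) * F (U v) (max 0 r))"
        by (intro continuous_intros continuous_on_compose2[OF Fcont]) auto
      fix r
      have "norm (exp (- L * max 0 r) * F (U v) (max 0 r))
          \<le> exp (- L * max 0 r) * (K * (\<xi> + 2 * (norm v / L * exp (L * max 0 r))))"
        using Fb[of "max 0 r" v] by (auto simp: abs_mult)
      also have "\<dots> = K * (exp (- L * max 0 r) * \<xi> + 2 * (norm v / L))"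
        by (simp add: algebra_simps flip: exp_add)
      also have "\<dots> \<le> K * (1 * \<xi> + 2 * (norm v / L))"
        using L xi K by (intro mult_left_mono add_right_mono mult_right_mono) auto
      finally show "norm (exp (- L * max 0 r) * F (U v) (max 0 r)) \<le> K * (\<xi> + 2 * (norm v / L))" by simp
    qed
    then show ?thesis by (simp add: P_def Bcontfun_inverse)
  qed
  have contr: "dist (P v) (P v') \<le> 1 / 2 * dist v v'" for v v'
  proof (rule dist_bound)
    fix r :: real
    let ?r = "max 0 r"
    have UU: "U v s - U v' s = U (v - v') s" for s
      by (simp add: U_def right_diff_distrib)
    have d: "\<bar>weighted_primitive j (U v) ?r - weighted_primitive j (U v') ?r\<bar>
        \<le> norm (v - v') / L * exp (L * ?r)" for j
      unfolding weighted_primitive_diff[OF Ucont Ucont] UU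
      by (rule weighted_primitive_bound[OF Ucont Ub L]) simp
    have "\<bar>F (U v) ?r - F (U v') ?r\<bar> \<le> K * (2 * (norm (v - v') / L * exp (L * ?r)))"
      unfolding F_def
      by (rule order_trans[OF lip mult_left_mono])
         (use d[of 0] d[of c] K in linarith)+
    then have "\<bar>exp (- L * ?r) * (F (U v) ?r - F (U v') ?r)\<bar>
        \<le> exp (- L * ?r) * (K * (2 * (norm (v - v') / L * exp (L * ?r))))"
      unfolding abs_mult abs_exp_cancel by (rule mult_left_mono) simp
    also have "\<dots> = 1 / 2 * norm (v - v')" using K by (simp add: L_def field_simps flip: exp_add)
    finally show "dist (apply_bcontfun (P v) r) (apply_bcontfun (P v') r) \<le> 1 / 2 * dist v v'"
      by (simp add: Pv dist_norm right_diff_distrib)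
  qed
  have "\<exists>!v. P v = v"
    by (rule banach_fix_type[where c = "1 / 2"]) (use contr in auto)
  then obtain v where v: "P v = v" by blast
  have eq: "U v r = F (U v) r" if "r \<ge> 0" for r
  proof -
    have "U v r = exp (L * r) * (exp (- L * r) * F (U v) r)"
      using Pv[of v r] v that by (simp add: U_def)
    then show ?thesis by (simp flip: exp_add mult.assoc)
  qed
  \<comment> \<open>The image of 0 has norm at most \<open>K * \<xi>\<close>, and a contraction by
    1/2 at most doubles this at the fixed point. Linearity in \<open>\<xi>\<close> lets
    \<open>profile_exists\<close> make the solution small.\<close>
  have nv: "norm v \<le> 2 * K * \<xi>"
  proof -
    have "norm (P 0) \<le> K * \<xi>"
    proof (rule norm_bound)
      fix r
      have "norm (apply_bcontfun (P 0) r) \<le> exp (- L * max 0 r) * (K * \<xi>)"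
        using Fb[of "max 0 r" 0] by (simp add: Pv abs_mult)
      also have "\<dots> \<le> 1 * (K * \<xi>)" using L xi K by (intro mult_right_mono) auto
      finally show "norm (apply_bcontfun (P 0) r) \<le> K * \<xi>" by simp
    qed
    moreover have "norm (P v - P 0) \<le> 1 / 2 * norm v" using contr[of v 0] by (simp add: dist_norm)
    moreover have "norm v \<le> norm (P v - P 0) + norm (P 0)" using v norm_triangle_sub[of v "P 0"] by simp
    ultimately show ?thesis by simp
  qed
  show thesis
  proof (rule that[of "U v"])
    show "continuous_on {0..} (U v)" by (rule Ucont)
    show "U v r = f r (\<xi> + weighted_primitive 0 (U v) r) (- weighted_primitive c (U v) r)" if "r \<ge> 0" for r
      using eq[OF that] by (simp add: F_def)
    show "\<bar>U v r\<bar> \<le> 2 * K * \<xi> * exp (4 * K * r)" for r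
      using order_trans[OF Ub mult_right_mono[OF nv exp_ge_zero]] unfolding L_def .
  qed
qed

section \<open>The truncated nonlinearity\<close>

definition trunc :: "real \<Rightarrow> real \<Rightarrow> real" where
  "trunc m x = max 0 (min m x)"

lemma trunc_lipschitz: "\<bar>trunc m x - trunc m y\<bar> \<le> \<bar>x - y\<bar>"
  by (auto simp: trunc_def max_def min_def)

lemma trunc_bounds: "m \<ge> 0 \<Longrightarrow> 0 \<le> trunc m x" "m \<ge> 0 \<Longrightarrow> trunc m x \<le> m"
  by (auto simp: trunc_def)

lemma trunc_id: "0 \<le> x \<Longrightarrow> x \<le> m \<Longrightarrow> trunc m x = x"
  by (simp add: trunc_def)

text \<open>At the infimum \<open>a\<close> of the times with \<open>g <= 0\<close> one has
  \<open>g a = 0\<close>, and a positive derivative there would make \<open>g\<close> negative just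
  before. The premise \<open>step\<close> grants positivity on the whole past, because the sign of
  the derivative at an exit depends on the other component, which is controlled only through that
  past.\<close>

lemma positive_by_first_exit:
  fixes g g' :: "real \<Rightarrow> real"
  assumes deriv: "\<And>t. (g has_real_derivative g' t) (at t)"
    and start: "\<And>t. t \<le> t0 \<Longrightarrow> g t > 0"
    and step: "\<And>t. (\<And>s. s < t \<Longrightarrow> g s > 0) \<Longrightarrow> g t = 0 \<Longrightarrow> g' t > 0"
  shows "g t > 0"
proof (rule ccontr)
  assume neg: "\<not> g t > 0"
  have cont: "continuous_on UNIV g"
    using deriv DERIV_isCont continuous_at_imp_continuous_on by blast
  define S where "S = {s. g s \<le> 0}"
  have "bdd_below S"
    using start by (intro bdd_belowI[of _ t0]) (force simp: S_def not_less[symmetric])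
  moreover have "closed S" unfolding S_def by (intro closed_Collect_le cont continuous_on_const)
  moreover have "t \<in> S" using neg by (simp add: S_def)
  ultimately have S: "closed S" "S \<noteq> {}" "bdd_below S" by blast+
  define a where "a = Inf S"
  have a: "g a \<le> 0" using closed_contains_Inf[OF S(2,3,1)] by (simp add: a_def S_def)
  have before: "g s > 0" if "s < a" for s
    using cInf_lower[OF _ S(3), of s] that by (force simp: a_def S_def)
  have lim: "(g \<longlongrightarrow> g a) (at_left a)"
    using DERIV_isCont[OF deriv] by (simp add: isCont_def filterlim_at_split)
  have "g a \<ge> 0"
    by (rule tendsto_lowerbound[OF lim]) (auto simp: eventually_at_left_field intro!: less_imp_le before exI[of _ "a - 1"])
  with a have ga: "g a = 0" by simp
  from DERIV_pos_inc_left[OF deriv step[OF before ga]]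
  obtain d where d: "d > 0" "\<And>h. h > 0 \<Longrightarrow> h < d \<Longrightarrow> g (a - h) < g a" by blast
  with before[of "a - d / 2"] d(2)[of "d / 2"] ga show False by auto
qed

section \<open>The cone system and its cubic remainder at the saddle\<close>

locale cone_ode =
  fixes k p :: nat and \<mu> :: real
  assumes k2: "k \<ge> 2" and p1: "p \<ge> 1" and mu: "real p * \<mu> = real k * (real k + real p)"
begin

lemma mu_gt_1: "\<mu> > 1"
proof -
  have "real p * 1 < real k * (real k + real p)"
    using k2 p1 mult_mono[of 2 "real k" "real k + real p" "real k + real p"] by simp
  then show ?thesis using mu p1 mult_less_cancel_left_pos[of "real p" 1 \<mu>] by simp
qed

lemma denom_pos: "1 + \<mu> * x\<^sup>2 > 0" "1 + \<mu> * x\<^sup>2 \<ge> 1" "1 + \<mu> * x\<^sup>2 \<noteq> 0"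
proof -
  show "1 + \<mu> * x\<^sup>2 \<ge> 1" using mu_gt_1 by simp
  then show "1 + \<mu> * x\<^sup>2 > 0" "1 + \<mu> * x\<^sup>2 \<noteq> 0" by linarith+
qed

text \<open>The derivative of w = \<phi> + \<psi>: adding the two equations cancels the linear term
  in \<psi>.\<close>

definition accel :: "real \<Rightarrow> real \<Rightarrow> real" where
  "accel x w = - (1 + w\<^sup>2) * ((1 + real p / (1 + \<mu> * x\<^sup>2)) * w - real p * \<mu> * x / (1 + \<mu> * x\<^sup>2))"

definition nonlin :: "real \<Rightarrow> real \<Rightarrow> real" where
  "nonlin x w = - (w ^ 3) - real p * ((w\<^sup>2 - \<mu> * x\<^sup>2) * (w - \<mu> * x)) / (1 + \<mu> * x\<^sup>2)"

lemma accel_split: "accel x w = - (1 + real p) * w + real p * \<mu> * x + nonlin x w"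
  unfolding accel_def nonlin_def using denom_pos(3)[of x]
  by (simp add: divide_simps) algebra

text \<open>Equal to k (k + p), the coefficient of x in the linear part. It also serves as a
  barrier: \<open>accel x bnd\<close> is negative for every x, since 2 x <= 1 + \<mu> x^2.\<close>

definition bnd :: real where "bnd = real p * \<mu>"

lemma bnd_pos: "bnd > 0" using mu_gt_1 p1 by (simp add: bnd_def)

definition lip :: real where
  "lip = 3 + real p * ((1 + \<mu>)\<^sup>2 * (3 + 2 * \<mu> * bnd\<^sup>2))"

lemma lip_pos: "lip > 0"
  unfolding lip_def using mu_gt_1 by (intro add_pos_nonneg mult_nonneg_nonneg) auto

text \<open>A cubic has Lipschitz constant of order m^2 on a box of side m, and this factor is what
  later beats the singular kernel. The products are telescoped; varying the denominator costs order
  m^4, which \<open>m <= bnd\<close> turns into \<open>bnd\<close>^2 m^2.\<close>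

lemma nonlin_lipschitz:
  assumes "0 \<le> x" "x \<le> m" "0 \<le> w" "w \<le> m" "0 \<le> x'" "x' \<le> m" "0 \<le> w'" "w' \<le> m" and mM: "m \<le> bnd"
  shows "\<bar>nonlin x w - nonlin x' w'\<bar> \<le> lip * m\<^sup>2 * (\<bar>x - x'\<bar> + \<bar>w - w'\<bar>)"
proof -
  define d where "d = \<bar>x - x'\<bar> + \<bar>w - w'\<bar>"
  have d: "\<bar>x - x'\<bar> \<le> d" "\<bar>w - w'\<bar> \<le> d" "d \<ge> 0" by (auto simp: d_def)
  have m: "m \<ge> 0" using assms by linarith
  have mu0: "\<mu> > 0" using mu_gt_1 by simp
  let ?q = "\<lambda>x w. (w\<^sup>2 - \<mu> * x\<^sup>2) * (w - \<mu> * x)"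
  let ?D = "\<lambda>x. 1 + \<mu> * x\<^sup>2"
  have sq: "\<bar>a\<^sup>2 - b\<^sup>2\<bar> \<le> 2 * m * d" if "\<bar>a - b\<bar> \<le> d" "0 \<le> a" "a \<le> m" "0 \<le> b" "b \<le> m" for a b
  proof -
    have "\<bar>a\<^sup>2 - b\<^sup>2\<bar> = (a + b) * \<bar>a - b\<bar>"
      using that by (simp add: power2_eq_square square_diff_square_factored abs_mult)
    also have "\<dots> \<le> (2 * m) * d" by (intro mult_mono) (use that in auto)
    finally show ?thesis .
  qed
  have cube: "\<bar>w ^ 3 - w' ^ 3\<bar> \<le> 3 * m\<^sup>2 * d"
  proof -
    have "\<bar>w ^ 3 - w' ^ 3\<bar> = (w\<^sup>2 + w * w' + w'\<^sup>2) * \<bar>w - w'\<bar>"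
    proof -
      have "w ^ 3 - w' ^ 3 = (w\<^sup>2 + w * w' + w'\<^sup>2) * (w - w')" by algebra
      then show ?thesis using assms by (simp add: abs_mult)
    qed
    also have "\<dots> \<le> (m\<^sup>2 + m * m + m\<^sup>2) * d"
      by (intro mult_mono add_mono power_mono) (use assms d in auto)
    finally show ?thesis by (simp add: power2_eq_square algebra_simps)
  qed
  have lin: "\<bar>w - \<mu> * x\<bar> \<le> (1 + \<mu>) * m"
  proof -
    have "\<mu> * x \<le> \<mu> * m" "0 \<le> \<mu> * x" using assms mu0 by auto
    then show ?thesis using assms by (auto simp: algebra_simps abs_le_iff)
  qed
  have quad: "\<bar>w'\<^sup>2 - \<mu> * x'\<^sup>2\<bar> \<le> (1 + \<mu>) * m\<^sup>2"
  proof -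
    have "\<mu> * x'\<^sup>2 \<le> \<mu> * m\<^sup>2" "0 \<le> \<mu> * x'\<^sup>2" using assms mu0 by (auto intro!: mult_left_mono power_mono)
    moreover have "w'\<^sup>2 \<le> m\<^sup>2" "0 \<le> w'\<^sup>2" using assms by (auto intro!: power_mono)
    ultimately show ?thesis
      unfolding abs_le_iff distrib_right mult_1 using zero_le_power2[of m] by linarith
  qed
  have lin': "\<bar>w' - \<mu> * x'\<bar> \<le> (1 + \<mu>) * m"
  proof -
    have "\<mu> * x' \<le> \<mu> * m" "0 \<le> \<mu> * x'" using assms mu0 by auto
    then show ?thesis using assms by (auto simp: algebra_simps abs_le_iff)
  qed
  have dlin: "\<bar>(w - w') - \<mu> * (x - x')\<bar> \<le> (1 + \<mu>) * d"
  proof -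
    have "\<mu> * \<bar>x - x'\<bar> \<le> \<mu> * d" using d mu0 by simp
    then have "\<bar>\<mu> * (x - x')\<bar> \<le> \<mu> * d" using mu0 by (simp add: abs_mult)
    then show ?thesis using d by (simp add: algebra_simps)
  qed
  have dquad: "\<bar>(w\<^sup>2 - w'\<^sup>2) - \<mu> * (x\<^sup>2 - x'\<^sup>2)\<bar> \<le> (1 + \<mu>) * (2 * m * d)"
  proof -
    have "\<bar>\<mu> * (x\<^sup>2 - x'\<^sup>2)\<bar> \<le> \<mu> * (2 * m * d)"
      using sq[of x x'] assms d mu0 by (simp add: abs_mult)
    moreover have "\<bar>w\<^sup>2 - w'\<^sup>2\<bar> \<le> 2 * m * d" using sq[of w w'] assms d by simp
    ultimately show ?thesis by (simp add: algebra_simps)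
  qed
  have q: "\<bar>?q x w - ?q x' w'\<bar> \<le> 3 * (1 + \<mu>)\<^sup>2 * m\<^sup>2 * d"
  proof -
    have "?q x w - ?q x' w' = ((w\<^sup>2 - w'\<^sup>2) - \<mu> * (x\<^sup>2 - x'\<^sup>2)) * (w - \<mu> * x)
        + (w'\<^sup>2 - \<mu> * x'\<^sup>2) * ((w - w') - \<mu> * (x - x'))" by algebra
    also have "\<bar>\<dots>\<bar> \<le> ((1 + \<mu>) * (2 * m * d)) * ((1 + \<mu>) * m) + ((1 + \<mu>) * m\<^sup>2) * ((1 + \<mu>) * d)"
      by (rule order_trans[OF abs_triangle_ineq], unfold abs_mult, intro add_mono mult_mono lin quad dlin dquad)
        (use m d mu0 in auto)
    finally show ?thesis by (simp add: power2_eq_square algebra_simps)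
  qed
  have q': "\<bar>?q x' w'\<bar> \<le> (1 + \<mu>)\<^sup>2 * m ^ 3"
  proof -
    have "\<bar>?q x' w'\<bar> \<le> ((1 + \<mu>) * m\<^sup>2) * ((1 + \<mu>) * m)"
      unfolding abs_mult by (intro mult_mono quad lin') (use m mu0 in auto)
    then show ?thesis by (simp add: power2_eq_square power3_eq_cube algebra_simps)
  qed
  have inv: "\<bar>1 / ?D x - 1 / ?D x'\<bar> \<le> \<mu> * (2 * m * d)"
  proof -
    have "\<bar>1 / ?D x - 1 / ?D x'\<bar> = \<mu> * \<bar>x\<^sup>2 - x'\<^sup>2\<bar> / (?D x * ?D x')"
    proof -
      have "1 / ?D x - 1 / ?D x' = \<mu> * (x'\<^sup>2 - x\<^sup>2) / (?D x * ?D x')"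
        using denom_pos(3)[of x] denom_pos(3)[of x'] by (simp add: divide_simps) (simp add: algebra_simps)
      then show ?thesis using denom_pos(1)[of x] denom_pos(1)[of x'] mu0
        by (simp add: abs_mult abs_minus_commute)
    qed
    also have "\<dots> \<le> \<mu> * \<bar>x\<^sup>2 - x'\<^sup>2\<bar> / 1"
      by (rule divide_left_mono)
        (use denom_pos(2)[of x] denom_pos(2)[of x'] mult_mono[OF denom_pos(2)[of x] denom_pos(2)[of x']] mu0 in auto)
    also have "\<dots> \<le> \<mu> * (2 * m * d)" using sq[of x x'] assms d mu0 by simp
    finally show ?thesis .
  qed
  have quot: "\<bar>?q x w / ?D x - ?q x' w' / ?D x'\<bar> \<le> (1 + \<mu>)\<^sup>2 * (3 + 2 * \<mu> * bnd\<^sup>2) * (m\<^sup>2 * d)"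
  proof -
    have "?q x w / ?D x - ?q x' w' / ?D x' = (?q x w - ?q x' w') / ?D x + ?q x' w' * (1 / ?D x - 1 / ?D x')"
      by (simp add: diff_divide_distrib right_diff_distrib)
    also have "\<bar>\<dots>\<bar> \<le> 3 * (1 + \<mu>)\<^sup>2 * m\<^sup>2 * d / 1 + ((1 + \<mu>)\<^sup>2 * m ^ 3) * (\<mu> * (2 * m * d))"
    proof (rule order_trans[OF abs_triangle_ineq], rule add_mono)
      show "\<bar>(?q x w - ?q x' w') / ?D x\<bar> \<le> 3 * (1 + \<mu>)\<^sup>2 * m\<^sup>2 * d / 1"
        unfolding abs_divide by (rule frac_le) (use q d denom_pos(2)[of x] in auto)
      show "\<bar>?q x' w' * (1 / ?D x - 1 / ?D x')\<bar> \<le> ((1 + \<mu>)\<^sup>2 * m ^ 3) * (\<mu> * (2 * m * d))"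
        unfolding abs_mult[of "?q x' w'"] by (rule mult_mono[OF q' inv]) (use m in auto)
    qed
    also have "\<dots> = (1 + \<mu>)\<^sup>2 * (3 + 2 * \<mu> * m\<^sup>2) * (m\<^sup>2 * d)" by algebra
    also have "\<dots> \<le> (1 + \<mu>)\<^sup>2 * (3 + 2 * \<mu> * bnd\<^sup>2) * (m\<^sup>2 * d)"
      by (intro mult_right_mono mult_left_mono add_left_mono power_mono) (use m mM mu0 d in auto)
    finally show ?thesis .
  qed
  have "nonlin x w - nonlin x' w' = - (w ^ 3 - w' ^ 3) - real p * (?q x w / ?D x - ?q x' w' / ?D x')"
    unfolding nonlin_def by (simp only: times_divide_eq_right[symmetric]) (simp add: algebra_simps)
  also have "\<bar>\<dots>\<bar> \<le> 3 * m\<^sup>2 * d + real p * ((1 + \<mu>)\<^sup>2 * (3 + 2 * \<mu> * bnd\<^sup>2) * (m\<^sup>2 * d))"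
  proof -
    have "\<bar>real p * (?q x w / ?D x - ?q x' w' / ?D x')\<bar> \<le> real p * ((1 + \<mu>)\<^sup>2 * (3 + 2 * \<mu> * bnd\<^sup>2) * (m\<^sup>2 * d))"
      unfolding abs_mult[of "real p"] by (simp only: abs_of_nat) (intro mult_left_mono quot of_nat_0_le_iff)
    then show ?thesis using cube by linarith
  qed
  also have "\<dots> = lip * m\<^sup>2 * d" by (simp add: lip_def algebra_simps)
  finally show ?thesis by (simp add: d_def)
qed


text \<open>The linear decay at r = 0 makes the forcing Lipschitz there in spite of its denominator
  r^k; the constant height for r >= 1 is the a priori bound on the orbit.\<close>

definition cutoff :: "real \<Rightarrow> real" where "cutoff r = bnd * min 1 r"

lemma cutoff_bounds: "r \<ge> 0 \<Longrightarrow> 0 \<le> cutoff r" "cutoff r \<le> bnd"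
  using bnd_pos by (auto simp: cutoff_def min_def)

definition slope :: "real \<Rightarrow> real \<Rightarrow> real" where
  "slope A B = real k * A - (real k + real p) * B"

text \<open>The component of the remainder along the unstable direction. The factor 2 k + p is the
  gap between the two eigenvalues, and r^k combines the scaling r^(k-1) with dt = dr / r.\<close>

definition forcing :: "real \<Rightarrow> real \<Rightarrow> real \<Rightarrow> real" where
  "forcing r A B = nonlin (trunc (cutoff r) (r ^ (k - 1) * (A + B))) (trunc (cutoff r) (r ^ (k - 1) * slope A B))
     / (real (2 * k + p) * r ^ k)"

definition lipF :: real where
  "lipF = lip * bnd\<^sup>2 * (1 + real k + real p)"

lemma lipF_pos: "lipF > 0"
  using lip_pos bnd_pos by (simp add: lipF_def)

text \<open>Division by zero gives the value \<open>0\<close> at \<open>r = 0\<close>, which is also the limit (\<open>forcing_small\<close>).\<close>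
lemma forcing_0 [simp]: "forcing 0 A B = 0"
  using k2 by (simp add: forcing_def)

lemma forcing_zero [simp]: "forcing r 0 0 = 0"
  by (simp add: forcing_def slope_def nonlin_def trunc_def min_def max_def)

text \<open>The truncated remainder contributes min(1, r)^2, its arguments r^(k-1) and the prefactor
  r^(-k). The resulting min(1, r)^2 / r is at most 1, which gives the global constant, and at most
  r, which gives continuity at 0.\<close>

lemma forcing_lipschitz_aux:
  assumes r: "r > 0"
  shows "\<bar>forcing r A B - forcing r A' B'\<bar> \<le> lipF * (min 1 r)\<^sup>2 / r * (\<bar>A - A'\<bar> + \<bar>B - B'\<bar>)"
proof -
  define d where "d = \<bar>A - A'\<bar> + \<bar>B - B'\<bar>"
  let ?s = "r ^ (k - 1)"
  let ?m = "cutoff r"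
  have m: "?m \<ge> 0" "?m \<le> bnd" using cutoff_bounds r by auto
  have s: "?s > 0" using r by simp
  let ?x = "trunc ?m (?s * (A + B))" and ?x' = "trunc ?m (?s * (A' + B'))"
  let ?w = "trunc ?m (?s * slope A B)" and ?w' = "trunc ?m (?s * slope A' B')"
  have "\<bar>?x - ?x'\<bar> \<le> ?s * d"
  proof -
    have "\<bar>?x - ?x'\<bar> \<le> \<bar>?s * (A + B) - ?s * (A' + B')\<bar>" by (rule trunc_lipschitz)
    also have "\<dots> = ?s * \<bar>(A + B) - (A' + B')\<bar>"
      using s by (simp add: abs_mult flip: right_diff_distrib)
    also have "\<dots> \<le> ?s * d" using s by (intro mult_left_mono) (auto simp: d_def)
    finally show ?thesis .
  qed
  moreover have "\<bar>?w - ?w'\<bar> \<le> ?s * ((real k + real p) * d)"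
  proof -
    have "\<bar>?w - ?w'\<bar> \<le> \<bar>?s * slope A B - ?s * slope A' B'\<bar>" by (rule trunc_lipschitz)
    also have "\<dots> = ?s * \<bar>slope A B - slope A' B'\<bar>"
      using s by (simp add: abs_mult flip: right_diff_distrib)
    also have "\<bar>slope A B - slope A' B'\<bar> \<le> (real k + real p) * d"
    proof -
      have "slope A B - slope A' B' = real k * (A - A') - (real k + real p) * (B - B')"
        by (simp add: slope_def algebra_simps)
      also have "\<bar>\<dots>\<bar> \<le> \<bar>real k * (A - A')\<bar> + \<bar>(real k + real p) * (B - B')\<bar>"
        by (rule abs_triangle_ineq4)
      also have "\<dots> \<le> (real k + real p) * \<bar>A - A'\<bar> + (real k + real p) * \<bar>B - B'\<bar>"
        unfolding abs_mult by (intro add_mono mult_right_mono) auto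
      finally show ?thesis by (simp add: d_def algebra_simps)
    qed
    finally show ?thesis using s by simp
  qed
  ultimately have xw: "\<bar>?x - ?x'\<bar> + \<bar>?w - ?w'\<bar> \<le> ?s * ((1 + real k + real p) * d)"
    by (simp add: algebra_simps)
  have "\<bar>nonlin ?x ?w - nonlin ?x' ?w'\<bar> \<le> lip * ?m\<^sup>2 * (\<bar>?x - ?x'\<bar> + \<bar>?w - ?w'\<bar>)"
    by (rule nonlin_lipschitz) (use trunc_bounds m in auto)
  also have "\<dots> \<le> lip * ?m\<^sup>2 * (?s * ((1 + real k + real p) * d))"
    by (rule mult_left_mono[OF xw]) (use lip_pos in auto)
  also have "\<dots> = lipF * (min 1 r)\<^sup>2 * d * ?s"
    by (simp add: lipF_def cutoff_def power_mult_distrib)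
  finally have N: "\<bar>nonlin ?x ?w - nonlin ?x' ?w'\<bar> \<le> lipF * (min 1 r)\<^sup>2 * d * ?s" .
  have rk: "r ^ k = r * ?s" using k2 by (cases k) auto
  have "\<bar>forcing r A B - forcing r A' B'\<bar> = \<bar>nonlin ?x ?w - nonlin ?x' ?w'\<bar> / (real (2 * k + p) * r ^ k)"
    unfolding forcing_def using r by (simp add: abs_mult flip: diff_divide_distrib)
  also have "\<dots> \<le> (lipF * (min 1 r)\<^sup>2 * d * ?s) / (1 * r ^ k)"
    by (intro frac_le mult_right_mono N) (use r k2 lipF_pos in \<open>auto simp: d_def\<close>)
  also have "\<dots> = lipF * (min 1 r)\<^sup>2 / r * d" using r s by (simp add: rk)
  finally show ?thesis by (simp add: d_def)
qed

lemma forcing_lipschitz: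
  assumes "r \<ge> 0"
  shows "\<bar>forcing r A B - forcing r A' B'\<bar> \<le> lipF * (\<bar>A - A'\<bar> + \<bar>B - B'\<bar>)"
proof (cases "r > 0")
  case True
  have "(min 1 r)\<^sup>2 \<le> 1 * r"
    unfolding power2_eq_square by (rule mult_mono) (use True in auto)
  then have "(min 1 r)\<^sup>2 / r \<le> 1" using True by simp
  then have "lipF * ((min 1 r)\<^sup>2 / r) * (\<bar>A - A'\<bar> + \<bar>B - B'\<bar>) \<le> lipF * 1 * (\<bar>A - A'\<bar> + \<bar>B - B'\<bar>)"
    using lipF_pos by (intro mult_right_mono mult_left_mono) auto
  then show ?thesis using forcing_lipschitz_aux[OF True, of A B A' B'] by simp
next
  case False
  then show ?thesis using assms lipF_pos by simp
qed

lemma forcing_small: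
  assumes "r \<ge> 0"
  shows "\<bar>forcing r A B\<bar> \<le> lipF * r * (\<bar>A\<bar> + \<bar>B\<bar>)"
proof (cases "r > 0")
  case True
  have "(min 1 r)\<^sup>2 / r \<le> r\<^sup>2 / r"
    using True by (intro divide_right_mono power_mono) auto
  also have "\<dots> = r" using True by (simp add: power2_eq_square)
  finally have "lipF * ((min 1 r)\<^sup>2 / r) * (\<bar>A\<bar> + \<bar>B\<bar>) \<le> lipF * r * (\<bar>A\<bar> + \<bar>B\<bar>)"
    using lipF_pos by (intro mult_right_mono mult_left_mono) auto
  then show ?thesis using forcing_lipschitz_aux[OF True, of A B 0 0] by simp
next
  case False
  then show ?thesis using assms by simp
qed

lemma forcing_continuous:
  assumes A: "continuous_on {0..} A" and B: "continuous_on {0..} B"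
  shows "continuous_on {0..} (\<lambda>r. forcing r (A r) (B r))"
  unfolding continuous_on_eq_continuous_within
proof safe
  fix r :: real assume "r \<ge> 0"
  show "continuous (at r within {0..}) (\<lambda>r. forcing r (A r) (B r))"
  proof (cases "r > 0")
    case True
    have [continuous_intros]: "continuous_on {0<..} A" "continuous_on {0<..} B"
      by (auto intro: continuous_on_subset[OF A] continuous_on_subset[OF B])
    have "continuous_on {0<..} (\<lambda>r. forcing r (A r) (B r))"
      unfolding forcing_def nonlin_def trunc_def cutoff_def slope_def
      by (intro continuous_intros ballI) (use denom_pos(3) k2 in auto)
    then have "isCont (\<lambda>r. forcing r (A r) (B r)) r"
      using True by (simp add: continuous_on_eq_continuous_at)
    then show ?thesis by (rule continuous_at_imp_continuous_within)
  next
    case False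
    with \<open>r \<ge> 0\<close> have r: "r = 0" by simp
    have "((\<lambda>r. forcing r (A r) (B r)) \<longlongrightarrow> 0) (at 0 within {0..})"
    proof (rule Lim_null_comparison)
      show "\<forall>\<^sub>F r in at 0 within {0..}. norm (forcing r (A r) (B r)) \<le> lipF * r * (\<bar>A r\<bar> + \<bar>B r\<bar>)"
        using forcing_small by (auto simp: eventually_at_filter)
      have "(A \<longlongrightarrow> A 0) (at 0 within {0..})" "(B \<longlongrightarrow> B 0) (at 0 within {0..})"
        using A B by (auto simp: continuous_on_def)
      then have "((\<lambda>r. lipF * r * (\<bar>A r\<bar> + \<bar>B r\<bar>)) \<longlongrightarrow> lipF * 0 * (\<bar>A 0\<bar> + \<bar>B 0\<bar>)) (at 0 within {0..})"
        by (intro tendsto_intros)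
      then show "((\<lambda>r. lipF * r * (\<bar>A r\<bar> + \<bar>B r\<bar>)) \<longlongrightarrow> 0) (at 0 within {0..})" by simp
    qed
    then show ?thesis by (simp add: continuous_within r)
  qed
qed

text \<open>The parameter \<open>\<xi>\<close> is the amplitude of the unstable mode. The factor 2 k
  + p in the last bound dominates the coefficients of both A + B and \<open>slope A B\<close>, so
  one estimate serves both components for t <= 0.\<close>

lemma profile_exists:
  obtains A B :: "real \<Rightarrow> real" and \<xi> where "\<xi> > 0"
    and "\<And>r. r > 0 \<Longrightarrow> (A has_real_derivative forcing r (A r) (B r)) (at r)"
    and "\<And>r. r > 0 \<Longrightarrow> (B has_real_derivative - (forcing r (A r) (B r)) - real (2 * k + p) * B r / r) (at r)"
    and "(A \<longlongrightarrow> \<xi>) (at_right 0)" and "(B \<longlongrightarrow> 0) (at_right 0)"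
    and "\<And>r. 0 \<le> r \<Longrightarrow> r \<le> 1 \<Longrightarrow> real (2 * k + p) * (\<bar>A r\<bar> + \<bar>B r\<bar>) < bnd"
proof -
  define c where "c = 2 * k + p"
  have c1: "real c \<ge> 1" using k2 by (simp add: c_def)
  define E where "E = exp (4 * lipF)"
  have E: "E > 0" by (simp add: E_def)
  \<comment> \<open>On [0, 1] each primitive is at most \<open>\<xi> * E / 2\<close>, so |A| + |B|
    is at most \<open>\<xi> * (1 + E)\<close>; this choice leaves a margin of a factor 2 below
    \<open>bnd\<close>.\<close>
  define \<xi> where "\<xi> = bnd / (2 * real c * (1 + E))"
  have xi: "\<xi> > 0" using bnd_pos c1 E by (simp add: \<xi>_def)
  obtain u where u: "continuous_on {0..} u"
    and eq: "\<And>r. r \<ge> 0 \<Longrightarrow> u r = forcing r (\<xi> + weighted_primitive 0 u r) (- weighted_primitive c u r)"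
    and b: "\<And>r. r \<ge> 0 \<Longrightarrow> \<bar>u r\<bar> \<le> 2 * lipF * \<xi> * exp (4 * lipF * r)"
    by (rule singular_volterra_solution[OF forcing_continuous forcing_lipschitz forcing_zero lipF_pos less_imp_le[OF xi]])
      (assumption | rule that)+
  define A where "A r = \<xi> + weighted_primitive 0 u r" for r
  define B where "B r = - weighted_primitive c u r" for r
  have L: "4 * lipF > 0" using lipF_pos by simp
  have lim: "(weighted_primitive j u \<longlongrightarrow> 0) (at_right 0)" for j
  proof -
    have "\<forall>r\<in>{0..}. (weighted_primitive j u \<longlongrightarrow> weighted_primitive j u r) (at r within {0..})"
      using weighted_primitive_continuous[OF u b L, of j] unfolding continuous_on_def .
    from bspec[OF this, of 0] have "(weighted_primitive j u \<longlongrightarrow> 0) (at 0 within {0..})" by simp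
    then show ?thesis by (rule tendsto_within_subset) auto
  qed
  have bound: "\<bar>weighted_primitive j u r\<bar> \<le> \<xi> * E / 2" if "0 \<le> r" "r \<le> 1" for j r
  proof -
    have "\<bar>weighted_primitive j u r\<bar> \<le> 2 * lipF * \<xi> / (4 * lipF) * exp (4 * lipF * r)"
      by (rule weighted_primitive_bound[OF u b L that(1)])
    also have "\<dots> = \<xi> / 2 * exp (4 * lipF * r)" using lipF_pos by simp
    also have "\<dots> \<le> \<xi> / 2 * E" using xi that lipF_pos by (intro mult_left_mono) (auto simp: E_def)
    finally show ?thesis by simp
  qed
  show thesis
  proof (rule that[OF xi, of A B])
    show "(A has_real_derivative forcing r (A r) (B r)) (at r)" if "r > 0" for r
      unfolding A_def[abs_def] B_def
      using weighted_primitive_deriv[OF u that, of 0] eq[of r] that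
      by (auto intro!: derivative_eq_intros)
    show "(B has_real_derivative - (forcing r (A r) (B r)) - real (2 * k + p) * B r / r) (at r)" if "r > 0" for r
      unfolding A_def B_def[abs_def] c_def[symmetric]
      using DERIV_minus[OF weighted_primitive_deriv[OF u that, of c]] eq[of r] that
      by (simp add: algebra_simps)
    show "(A \<longlongrightarrow> \<xi>) (at_right 0)"
      unfolding A_def[abs_def] using tendsto_add[OF tendsto_const lim[of 0], of \<xi>] by simp
    show "(B \<longlongrightarrow> 0) (at_right 0)"
      unfolding B_def[abs_def] using tendsto_minus[OF lim[of c]] by simp
    show "real (2 * k + p) * (\<bar>A r\<bar> + \<bar>B r\<bar>) < bnd" if "0 \<le> r" "r \<le> 1" for r
    proof -
      have "\<bar>A r\<bar> + \<bar>B r\<bar> \<le> \<xi> * (1 + E)"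
        using bound[OF that, of 0] bound[OF that, of c] xi unfolding A_def B_def
        by (simp add: algebra_simps)
      then have "real c * (\<bar>A r\<bar> + \<bar>B r\<bar>) \<le> real c * (\<xi> * (1 + E))" using c1 by simp
      also have "\<dots> = bnd / 2" using c1 E by (simp add: \<xi>_def)
      also have "\<dots> < bnd" using bnd_pos by simp
      finally show ?thesis by (simp add: c_def)
    qed
  qed
qed

section \<open>Existence of the unstable orbit\<close>


lemma truncated_solution_exists:
  obtains x w :: "real \<Rightarrow> real" and t0 where
    "\<And>t. (x has_real_derivative w t - x t) (at t)"
    and "\<And>t. (w has_real_derivative - (1 + real p) * w t + bnd * x t
           + nonlin (trunc (cutoff (exp t)) (x t)) (trunc (cutoff (exp t)) (w t))) (at t)"
    and "\<And>t. t \<le> t0 \<Longrightarrow> 0 < x t \<and> x t < w t"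
    and "\<And>t. t \<le> 0 \<Longrightarrow> \<bar>x t\<bar> < bnd * exp (real (k - 1) * t) \<and> \<bar>w t\<bar> < bnd * exp (real (k - 1) * t)"
proof -
  obtain A B and \<xi> :: real where xi: "\<xi> > 0"
    and A: "\<And>r. r > 0 \<Longrightarrow> (A has_real_derivative forcing r (A r) (B r)) (at r)"
    and B: "\<And>r. r > 0 \<Longrightarrow> (B has_real_derivative - (forcing r (A r) (B r)) - real (2 * k + p) * B r / r) (at r)"
    and limA: "(A \<longlongrightarrow> \<xi>) (at_right 0)" and limB: "(B \<longlongrightarrow> 0) (at_right 0)"
    and bd: "\<And>r. 0 \<le> r \<Longrightarrow> r \<le> 1 \<Longrightarrow> real (2 * k + p) * (\<bar>A r\<bar> + \<bar>B r\<bar>) < bnd"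
    using profile_exists by metis
  define x where "x t = exp t ^ (k - 1) * (A (exp t) + B (exp t))" for t
  define w where "w t = exp t ^ (k - 1) * slope (A (exp t)) (B (exp t))" for t
  define F where "F t = forcing (exp t) (A (exp t)) (B (exp t))" for t
  have k1: "real (k - 1) = real k - 1" using k2 by simp
  have dA: "((\<lambda>t. A (exp t)) has_real_derivative F t * exp t) (at t)" for t
    unfolding F_def by (rule DERIV_chain2[OF A DERIV_exp]) simp
  have dB: "((\<lambda>t. B (exp t)) has_real_derivative (- F t - real (2 * k + p) * B (exp t) / exp t) * exp t) (at t)" for t
    unfolding F_def by (rule DERIV_chain2[OF B DERIV_exp]) simp
  have dE: "((\<lambda>t. exp t ^ (k - 1)) has_real_derivative real (k - 1) * exp t ^ (k - 1)) (at t)" for t :: real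
  proof -
    have "((\<lambda>t. exp (real (k - 1) * t)) has_real_derivative real (k - 1) * exp (real (k - 1) * t)) (at t)"
      by (auto intro!: derivative_eq_intros)
    then show ?thesis by (simp only: exp_of_nat_mult)
  qed
  have dx: "(x has_real_derivative w t - x t) (at t)" for t
    unfolding x_def[abs_def] w_def slope_def
    by (rule DERIV_cong[OF DERIV_mult[OF dE DERIV_add[OF dA dB]]], unfold k1)
      (simp add: field_simps)
  have NF: "exp t ^ (k - 1) * (real (2 * k + p) * (F t * exp t))
      = nonlin (trunc (cutoff (exp t)) (x t)) (trunc (cutoff (exp t)) (w t))" for t
  proof -
    define c where "c = real (2 * k + p)"
    have c: "c \<noteq> 0" using k2 by (simp add: c_def)
    have "exp t ^ (k - 1) * (c * (F t * exp t)) = F t * (c * exp t ^ k)"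
      using k2 by (cases k) auto
    also have "\<dots> = nonlin (trunc (cutoff (exp t)) (x t)) (trunc (cutoff (exp t)) (w t))"
      unfolding F_def forcing_def x_def w_def c_def[symmetric] using c by simp
    finally show ?thesis by (simp only: c_def)
  qed
  have dw: "(w has_real_derivative - (1 + real p) * w t + bnd * x t
           + nonlin (trunc (cutoff (exp t)) (x t)) (trunc (cutoff (exp t)) (w t))) (at t)" for t
    unfolding NF[symmetric]
    unfolding w_def[abs_def] x_def slope_def
  proof (rule DERIV_cong[OF DERIV_mult[OF dE DERIV_diff[OF DERIV_cmult[OF dA] DERIV_cmult[OF dB]]]], goal_cases)
    case 1
    define r where "r = exp t"
    define s where "s = r ^ (k - 1)"
    define a where "a = A r"
    define b where "b = B r"
    have eq: "(- F t - real (2 * k + p) * b / r) * r = - (F t * r) - (2 * real k + real p) * b"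
      by (simp add: r_def field_simps)
    show ?case
      unfolding r_def[symmetric] a_def[symmetric] b_def[symmetric] s_def[symmetric] bnd_def mu k1 eq
      by (simp add: algebra_simps)
  qed
  have pos: "\<exists>t0. \<forall>t\<le>t0. 0 < x t \<and> x t < w t"
  proof -
    have "((\<lambda>r. A r + B r) \<longlongrightarrow> \<xi> + 0) (at_right 0)" by (intro tendsto_intros limA limB)
    then have 1: "\<forall>\<^sub>F r in at_right 0. A r + B r > 0"
      by (rule order_tendstoD(1)) (use xi in simp)
    \<comment> \<open>The limit is (k - 1) \<open>\<xi>\<close>, positive because k >= 2: the orbit
      leaves the saddle with positive velocity.\<close>
    have "((\<lambda>r. slope (A r) (B r) - (A r + B r)) \<longlongrightarrow> (real k * \<xi> - (real k + real p) * 0) - (\<xi> + 0)) (at_right 0)"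
      unfolding slope_def by (intro tendsto_intros limA limB)
    then have 2: "\<forall>\<^sub>F r in at_right 0. slope (A r) (B r) - (A r + B r) > 0"
      by (rule order_tendstoD(1)) (use xi k2 in simp)
    have "\<forall>\<^sub>F r in at_right 0. A r + B r > 0 \<and> slope (A r) (B r) > A r + B r"
      using 1 2 by eventually_elim auto
    then have "\<forall>\<^sub>F t in at_bot. A (exp t) + B (exp t) > 0 \<and> slope (A (exp t)) (B (exp t)) > A (exp t) + B (exp t)"
      by (rule eventually_compose_filterlim)
        (auto intro!: tendsto_imp_filterlim_at_right exp_at_bot)
    then obtain t0 where "\<forall>t\<le>t0. A (exp t) + B (exp t) > 0 \<and> slope (A (exp t)) (B (exp t)) > A (exp t) + B (exp t)"
      unfolding eventually_at_bot_linorder by blast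
    then have "\<forall>t\<le>t0. 0 < x t \<and> x t < w t" by (simp add: x_def w_def)
    then show ?thesis by blast
  qed
  have small: "\<bar>x t\<bar> < bnd * exp (real (k - 1) * t) \<and> \<bar>w t\<bar> < bnd * exp (real (k - 1) * t)" if "t \<le> 0" for t
  proof -
    let ?A = "A (exp t)" and ?B = "B (exp t)"
    have b: "real (2 * k + p) * (\<bar>?A\<bar> + \<bar>?B\<bar>) < bnd" using bd[of "exp t"] that by simp
    have "\<bar>?A + ?B\<bar> \<le> 1 * (\<bar>?A\<bar> + \<bar>?B\<bar>)" by simp
    also have "\<dots> \<le> real (2 * k + p) * (\<bar>?A\<bar> + \<bar>?B\<bar>)" using k2 by (intro mult_right_mono) auto
    finally have 1: "\<bar>?A + ?B\<bar> < bnd" using b by simp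
    have "\<bar>slope ?A ?B\<bar> \<le> \<bar>real k * ?A\<bar> + \<bar>(real k + real p) * ?B\<bar>"
      unfolding slope_def by (rule abs_triangle_ineq4)
    also have "\<dots> \<le> real (2 * k + p) * \<bar>?A\<bar> + real (2 * k + p) * \<bar>?B\<bar>"
      unfolding abs_mult by (intro add_mono mult_right_mono) auto
    finally have 2: "\<bar>slope ?A ?B\<bar> < bnd" using b by (simp add: distrib_left)
    show ?thesis
      unfolding x_def w_def exp_of_nat_mult abs_mult
      using 1 2 by (simp add: mult.commute)
  qed
  from pos obtain t0 where "\<And>t. t \<le> t0 \<Longrightarrow> 0 < x t \<and> x t < w t" by blast
  then show thesis using that[of x w t0] dx dw small by blast
qed

text \<open>With the integrating factor exp, g' + g = h > 0 makes exp t * g increasing. Positivity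
  of h is asked only before t, so that the lemma applies at a first exit time; it transfers bounds
  from w to x.\<close>

lemma relaxation_comparison:
  fixes g h :: "real \<Rightarrow> real"
  assumes deriv: "\<And>t. (g has_real_derivative h t - g t) (at t)"
    and start: "\<And>t. t \<le> t0 \<Longrightarrow> g t > 0" and h: "\<And>s. s < t \<Longrightarrow> h s > 0"
  shows "g t > 0"
proof (cases "t \<le> t0")
  case False
  have d: "((\<lambda>s. exp s * g s) has_real_derivative exp s * h s) (at s)" for s
    by (rule DERIV_cong[OF DERIV_mult[OF DERIV_exp deriv]]) (simp add: algebra_simps)
  have "exp t0 * g t0 < exp t * g t"
  proof (rule DERIV_pos_imp_increasing_open[where f = "\<lambda>s. exp s * g s"])
    show "t0 < t" using False by simp
    show "\<exists>y. ((\<lambda>s. exp s * g s) has_real_derivative y) (at s) \<and> y > 0" if "t0 < s" "s < t" for s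
      using d[of s] h[OF that(2)] by auto
    show "continuous_on {t0..t} (\<lambda>s. exp s * g s)"
      using d by (meson DERIV_isCont continuous_at_imp_continuous_on)
  qed
  moreover have "exp t0 * g t0 > 0" using start by simp
  ultimately have "exp t * g t > 0" by linarith
  then show ?thesis by (simp add: zero_less_mult_iff)
qed (use start in auto)

text \<open>Both bounds on \<open>w\<close> are proved at a first exit time, where
  \<open>relaxation_comparison\<close> has already carried the bound over to \<open>x\<close>. Once
  the box is known, the truncation is inactive for t >= 0; for t <= 0 the decay of order exp ((k -
  1) t) keeps the orbit below the shrinking cutoff.\<close>

lemma solution_exists:
  obtains x w :: "real \<Rightarrow> real" and t0 where
    "\<And>t. (x has_real_derivative w t - x t) (at t)"
    and "\<And>t. (w has_real_derivative accel (x t) (w t)) (at t)"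
    and "\<And>t. 0 < x t" and "\<And>t. x t < bnd" and "\<And>t. 0 < w t" and "\<And>t. w t < bnd"
    and "\<And>t. t \<le> t0 \<Longrightarrow> x t < w t"
    and "\<And>t. t \<le> 0 \<Longrightarrow> x t < bnd * exp (real (k - 1) * t)"
    and "\<And>t. t \<le> 0 \<Longrightarrow> w t < bnd * exp (real (k - 1) * t)"
proof -
  obtain x w :: "real \<Rightarrow> real" and t0 where
    dx: "\<And>t. (x has_real_derivative w t - x t) (at t)"
    and dw: "\<And>t. (w has_real_derivative - (1 + real p) * w t + bnd * x t
           + nonlin (trunc (cutoff (exp t)) (x t)) (trunc (cutoff (exp t)) (w t))) (at t)"
    and start: "\<And>t. t \<le> t0 \<Longrightarrow> 0 < x t \<and> x t < w t"
    and small: "\<And>t. t \<le> 0 \<Longrightarrow> \<bar>x t\<bar> < bnd * exp (real (k - 1) * t) \<and> \<bar>w t\<bar> < bnd * exp (real (k - 1) * t)"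
    by (rule truncated_solution_exists) (rule that; assumption)
  have mu0: "\<mu> > 0" using mu_gt_1 by simp
  have cut0: "cutoff (exp t) \<ge> 0" for t by (rule cutoff_bounds) simp
  have small': "bnd * exp (real (k - 1) * t) \<le> cutoff (exp t)" if "t \<le> 0" for t
  proof -
    have "real (k - 1) * t \<le> 1 * t" using that k2 by (intro mult_right_mono_neg) auto
    then show ?thesis using that bnd_pos by (simp add: cutoff_def)
  qed
  have cut_pos: "cutoff (exp t) = bnd" if "t \<ge> 0" for t
    using that by (simp add: cutoff_def)
  have w_pos: "w t > 0" for t
  proof (rule positive_by_first_exit[OF dw, of t0])
    show "w t > 0" if "t \<le> t0" for t using start[OF that] by simp
    fix t assume prev: "\<And>s. s < t \<Longrightarrow> w s > 0" and w0: "w t = 0"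
    have x: "x t > 0" by (rule relaxation_comparison[OF dx, of t0]) (use start prev in auto)
    define y where "y = trunc (cutoff (exp t)) (x t)"
    \<comment> \<open>Truncation only decreases \<open>x\<close>, so at \<open>w = 0\<close> the
      cubic term, which is less than \<open>bnd * y\<close> in size, cannot outweigh the linear term
      \<open>bnd * x\<close>.\<close>
    have y: "0 \<le> y" "y \<le> x t" using x cut0[of t] by (auto simp: y_def trunc_def)
    have "trunc (cutoff (exp t)) 0 = 0" using cut0[of t] by (simp add: trunc_def)
    then have "nonlin y (trunc (cutoff (exp t)) (w t)) = - (bnd * y * (\<mu> * y\<^sup>2 / (1 + \<mu> * y\<^sup>2)))"
      by (simp add: w0 nonlin_def bnd_def power2_eq_square field_simps)
    moreover have "bnd * y * (\<mu> * y\<^sup>2 / (1 + \<mu> * y\<^sup>2)) < bnd * x t"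
    proof -
      have "bnd * y * (\<mu> * y\<^sup>2 / (1 + \<mu> * y\<^sup>2)) \<le> bnd * x t * (\<mu> * y\<^sup>2 / (1 + \<mu> * y\<^sup>2))"
        using y bnd_pos mu0 denom_pos(1)[of y] by (intro mult_right_mono mult_left_mono) auto
      also have "\<dots> < bnd * x t * 1"
        using x bnd_pos denom_pos(1)[of y] by (intro mult_strict_left_mono) (auto simp: divide_less_eq_1)
      finally show ?thesis by simp
    qed
    ultimately show "- (1 + real p) * w t + bnd * x t
        + nonlin (trunc (cutoff (exp t)) (x t)) (trunc (cutoff (exp t)) (w t)) > 0"
      by (simp add: w0 y_def)
  qed
  have x_pos: "x t > 0" for t
    by (rule relaxation_comparison[OF dx, of t0]) (use start w_pos in auto)
  have start_less: "x t < bnd \<and> w t < bnd" if "t \<le> 0" for t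
  proof -
    have "bnd * exp (real (k - 1) * t) \<le> bnd"
      using that bnd_pos by (simp add: mult_le_0_iff)
    then show ?thesis using small[OF that] by linarith
  qed
  have dx': "((\<lambda>t. bnd - x t) has_real_derivative (bnd - w t) - (bnd - x t)) (at t)" for t
    by (rule DERIV_cong[OF DERIV_diff[OF DERIV_const dx]]) simp
  have w_less: "bnd - w t > 0" for t
  proof (rule positive_by_first_exit[OF DERIV_diff[OF DERIV_const dw], of 0])
    show "bnd - w t > 0" if "t \<le> 0" for t using start_less[OF that] by simp
    fix t assume prev: "\<And>s. s < t \<Longrightarrow> bnd - w s > 0" and w: "bnd - w t = 0"
    have x: "bnd - x t > 0"
      by (rule relaxation_comparison[OF dx', of 0]) (use start_less prev in auto)
    \<comment> \<open>An upper exit can occur only where the cutoff has its full height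
      \<open>bnd\<close>; there the truncation is already the identity and the barrier property of
      \<open>accel\<close> applies.\<close>
    have t: "t \<ge> 0" using start_less[of t] w by (cases "t \<ge> 0") auto
    have tr: "trunc (cutoff (exp t)) (x t) = x t" "trunc (cutoff (exp t)) (w t) = w t"
      using x w x_pos[of t] w_pos[of t] by (auto simp: cut_pos[OF t] intro!: trunc_id)
    have "real p * \<mu> * x t / (1 + \<mu> * (x t)\<^sup>2) \<le> bnd / 2"
    proof -
      have "2 * x t \<le> 1 + 1 * (x t)\<^sup>2"
        using sum_squares_bound[of 1 "x t"] by simp
      also have "\<dots> \<le> 1 + \<mu> * (x t)\<^sup>2" using mu_gt_1 by (intro add_left_mono mult_right_mono) auto
      finally have "bnd * (2 * x t) \<le> bnd * (1 + \<mu> * (x t)\<^sup>2)" using bnd_pos by simp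
      then show ?thesis using denom_pos(1)[of "x t"] by (simp add: bnd_def field_simps)
    qed
    moreover have "(1 + real p / (1 + \<mu> * (x t)\<^sup>2)) * w t \<ge> 1 * bnd"
      using w bnd_pos denom_pos(1)[of "x t"] by (intro mult_mono) auto
    ultimately have "(1 + real p / (1 + \<mu> * (x t)\<^sup>2)) * w t - real p * \<mu> * x t / (1 + \<mu> * (x t)\<^sup>2) > 0"
      using bnd_pos by linarith
    moreover have "1 + (w t)\<^sup>2 > 0" by (simp add: add_pos_nonneg)
    ultimately have "accel (x t) (w t) < 0"
      unfolding accel_def by (simp only: mult_minus_left neg_less_0_iff_less) (rule mult_pos_pos)
    then show "0 - (- (1 + real p) * w t + bnd * x t
        + nonlin (trunc (cutoff (exp t)) (x t)) (trunc (cutoff (exp t)) (w t))) > 0"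
      by (simp add: tr accel_split bnd_def)
  qed
  have x_less: "bnd - x t > 0" for t
    by (rule relaxation_comparison[OF dx', of 0]) (use start_less w_less in auto)
  have tr: "trunc (cutoff (exp t)) (x t) = x t \<and> trunc (cutoff (exp t)) (w t) = w t" for t
  proof (cases "t \<ge> 0")
    case True
    then show ?thesis using x_pos[of t] x_less[of t] w_pos[of t] w_less[of t]
      by (auto simp: cut_pos intro!: trunc_id)
  next
    case False
    then have "t \<le> 0" by simp
    from small[OF this] small'[OF this] show ?thesis using x_pos[of t] w_pos[of t]
      by (auto intro!: trunc_id)
  qed
  show thesis
  proof (rule that[of x w t0])
    show "(w has_real_derivative accel (x t) (w t)) (at t)" for t
      using dw[of t] tr[of t] by (simp add: accel_split bnd_def)
  qed (use dx x_pos x_less w_pos w_less start small in \<open>auto simp: abs_less_iff\<close>)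
qed

end

section \<open>Dissipation and the energy of minimal cones\<close>

text \<open>Once \<open>\<bar>f s\<bar> \<ge> \<epsilon>\<close>, the Lipschitz bound keeps \<open>\<bar>f\<bar> \<ge> \<epsilon> / 2\<close> for a fixed time, which costs \<open>F\<close> a fixed
  amount.\<close>
lemma tendsto_zero_by_dissipation:
  fixes F F' f f' :: "real \<Rightarrow> real"
  assumes F: "\<And>t. t \<ge> a \<Longrightarrow> (F has_real_derivative F' t) (at t)"
    and f: "\<And>t. t \<ge> a \<Longrightarrow> (f has_real_derivative f' t) (at t)"
    and diss: "\<And>t. t \<ge> a \<Longrightarrow> F' t \<ge> c * (f t)\<^sup>2" and c: "c > 0"
    and bnd: "\<And>t. t \<ge> a \<Longrightarrow> F t \<le> M" and lip: "\<And>t. t \<ge> a \<Longrightarrow> \<bar>f' t\<bar> \<le> K"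
  shows "(f \<longlongrightarrow> 0) at_top"
proof (rule tendstoI)
  fix e :: real assume e: "e > 0"
  define K' where "K' = max K 1"
  have K': "K' > 0" by (simp add: K'_def)
  define h where "h = e / (2 * K')"
  have h: "h > 0" using e K' by (simp add: h_def)
  define d where "d = c * (e / 2)\<^sup>2 * h"
  have d: "d > 0" using c e h by (simp add: d_def)
  define S where "S = Sup (F ` {a..})"
  have bdd: "bdd_above (F ` {a..})" using bnd by (auto intro!: bdd_aboveI[of _ M])
  have "\<exists>y\<in>F ` {a..}. S - d < y"
    by (rule less_cSupD) (use d in \<open>auto simp: S_def\<close>)
  \<comment> \<open>After \<open>T\<close> the nondecreasing \<open>F\<close> is within
    \<open>d\<close> of its supremum, so it can no longer gain \<open>d\<close>.\<close>
  then obtain T where T: "T \<ge> a" "S - d < F T" by auto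
  have mono: "F s \<le> F t" if "a \<le> s" "s \<le> t" for s t
  proof (rule DERIV_nonneg_imp_nondecreasing[OF that(2)])
    fix u assume "s \<le> u" "u \<le> t"
    then have "u \<ge> a" using that by simp
    moreover from this have "F' u \<ge> 0" using diss[of u] c by (smt (verit) zero_le_power2 mult_nonneg_nonneg)
    ultimately show "\<exists>y. (F has_real_derivative y) (at u) \<and> 0 \<le> y" using F by blast
  qed
  have "\<bar>f t\<bar> < e" if t: "t \<ge> T" for t
  proof (rule ccontr)
    assume big: "\<not> \<bar>f t\<bar> < e"
    have ta: "t \<ge> a" using t T by simp
    have stay: "\<bar>f s\<bar> \<ge> e / 2" if s: "t \<le> s" "s \<le> t + h" for s
    proof -
      have "norm (f s - f t) \<le> K' * norm (s - t)"
      proof (rule field_differentiable_bound[of "{t..s}" f f' K'])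
        show "(f has_real_derivative f' z) (at z within {t..s})" if "z \<in> {t..s}" for z
          by (rule DERIV_subset[OF f]) (use that ta in auto)
        show "norm (f' z) \<le> K'" if "z \<in> {t..s}" for z
          using lip[of z] that ta by (auto simp: K'_def)
      qed (use s in auto)
      also have "\<dots> \<le> K' * h" using s K' by (intro mult_left_mono) auto
      also have "\<dots> = e / 2" using K' by (simp add: h_def)
      finally show ?thesis using big unfolding real_norm_def by linarith
    qed
    have "F t + d \<le> F (t + h)"
    proof -
      have "\<exists>z>t. z < t + h \<and> F (t + h) - F t = (t + h - t) * F' z"
        by (rule MVT2) (use h F ta in auto)
      then obtain z where z: "t < z" "z < t + h" "F (t + h) - F t = h * F' z" by auto
      have "(e / 2)\<^sup>2 \<le> \<bar>f z\<bar>\<^sup>2"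
        by (rule power_mono) (use stay[of z] z e in auto)
      then have "c * (e / 2)\<^sup>2 \<le> c * (f z)\<^sup>2" using c by simp
      also have "\<dots> \<le> F' z" using diss z ta by simp
      finally have "h * (c * (e / 2)\<^sup>2) \<le> h * F' z" using h by simp
      then have "d \<le> h * F' z" by (simp add: d_def mult.commute)
      then show ?thesis using z(3) by linarith
    qed
    moreover have "F (t + h) \<le> S"
      unfolding S_def by (rule cSup_upper[OF _ bdd]) (use ta h in auto)
    moreover have "F T \<le> F t" by (rule mono) (use T t in auto)
    ultimately show False using T by simp
  qed
  then show "\<forall>\<^sub>F t in at_top. dist (f t) 0 < e"
    unfolding eventually_at_top_linorder by auto
qed

lemma sign_constant_on_interval:
  fixes f :: "real \<Rightarrow> real"
  assumes "continuous_on UNIV f" and "\<And>t. t \<in> I \<Longrightarrow> f t \<noteq> 0" and "is_interval I"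
    and "s \<in> I" "t \<in> I" "f s > 0"
  shows "f t > 0"
proof (rule ccontr)
  assume "\<not> f t > 0"
  with assms have ft: "f t < 0" by fastforce
  have "connected (f ` I)"
    by (rule connected_continuous_image)
      (use assms in \<open>auto intro: continuous_on_subset simp: is_interval_connected\<close>)
  then have "0 \<in> f ` I"
    by (rule connectedD_interval[where x = "f t" and y = "f s"]) (use assms ft in auto)
  then show False using assms(2) by auto
qed

context cone_ode
begin

section \<open>Oscillator form and energy landscape about the equilibrium\<close>

definition x0 :: real where "x0 = sqrt (real p - (real p + 1) / \<mu>)"

lemma bnd_gt: "bnd > real p + 1"
proof -
  have "real p + 1 < 2 * (2 + real p)" by simp
  also have "\<dots> \<le> real k * (real k + real p)" using k2 by (intro mult_mono) auto
  finally show ?thesis by (simp add: bnd_def mu)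
qed

lemma x0_sq: "x0\<^sup>2 = real p - (real p + 1) / \<mu>" and x0_pos: "x0 > 0"
  and mu_x0_sq: "1 + \<mu> * x0\<^sup>2 = real p * (\<mu> - 1)"
proof -
  have mu0: "\<mu> > 0" using mu_gt_1 by simp
  have "(real p + 1) / \<mu> < real p" using bnd_gt mu0 by (simp add: bnd_def divide_less_eq)
  then show sq: "x0\<^sup>2 = real p - (real p + 1) / \<mu>" and "x0 > 0" by (auto simp: x0_def)
  show "1 + \<mu> * x0\<^sup>2 = real p * (\<mu> - 1)" unfolding sq using mu0 by (simp add: field_simps)
qed

definition damping :: "real \<Rightarrow> real \<Rightarrow> real" where
  "damping x w = 1 + (1 + real p / (1 + \<mu> * x\<^sup>2)) * (1 + w\<^sup>2)"

definition stiffness :: "real \<Rightarrow> real \<Rightarrow> real" where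
  "stiffness x w = \<mu> * (x + x0) * x * (1 + w\<^sup>2) / (1 + \<mu> * x\<^sup>2)"

text \<open>The coefficient of x in the bracket has numerator 1 + \<mu> x^2 - p (\<mu> - 1), which
  vanishes at \<open>x0\<close> and hence factors as \<mu> (x + x0) (x - x0). For x > 0 the velocity
  therefore obeys a damped oscillator equation with positive coefficients.\<close>

lemma accel_oscillator:
  "accel x w - (w - x) = - damping x w * (w - x) + stiffness x w * (x0 - x)"
proof -
  define D where "D = 1 + \<mu> * x\<^sup>2"
  have D: "D \<noteq> 0" using denom_pos(3) by (simp add: D_def)
  have e: "D + real p - real p * \<mu> = \<mu> * (x + x0) * (x - x0)"
    using mu_x0_sq by (simp add: D_def power2_eq_square algebra_simps)
  have "accel x w = - (1 + w\<^sup>2) * ((1 + real p / D) * (w - x) + x * ((D + real p - real p * \<mu>) / D))"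
    unfolding accel_def D_def[symmetric] using D by (simp add: field_simps)
  also have "\<dots> = - (1 + w\<^sup>2) * ((1 + real p / D) * (w - x)) + \<mu> * (x + x0) * x * (1 + w\<^sup>2) / D * (x0 - x)"
    unfolding e using D by (simp add: field_simps)
  finally have acc: "accel x w = - (1 + w\<^sup>2) * ((1 + real p / D) * (w - x)) + stiffness x w * (x0 - x)"
    by (simp only: stiffness_def D_def)
  define r where "r = 1 + real p / D"
  show ?thesis
    unfolding acc damping_def D_def[symmetric] r_def[symmetric] by algebra
qed

text \<open>The logarithm of the monotone density: its derivative is a sum of four fractions, and
  its value at the saddle is 0.\<close>

definition energy :: "real \<Rightarrow> real \<Rightarrow> real" where
  "energy x w = ln (1 + x * w) - ln (1 + w\<^sup>2) / 2 + real p / 2 * ln (1 + \<mu> * x\<^sup>2)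
     - (real p / 2 + 1) * ln (1 + x\<^sup>2)"

definition rest_energy :: "real \<Rightarrow> real" where
  "rest_energy x = real p / 2 * ln (1 + \<mu> * x\<^sup>2) - (real p + 1) / 2 * ln (1 + x\<^sup>2)"

lemma one_plus_sq_pos: "1 + (a::real)\<^sup>2 > 0"
  by (simp add: add_pos_nonneg)

lemma energy_diag: "energy x x = rest_energy x"
  by (simp add: energy_def rest_energy_def field_simps flip: power2_eq_square)

text \<open>Cauchy-Schwarz for the vectors (1, x) and (1, w).\<close>

lemma energy_le_rest:
  assumes "1 + x * w > 0"
  shows "energy x w \<le> rest_energy x"
proof -
  have "(1 + x * w)\<^sup>2 \<le> (1 + x\<^sup>2) * (1 + w\<^sup>2)"
  proof -
    have "(1 + x\<^sup>2) * (1 + w\<^sup>2) - (1 + x * w)\<^sup>2 = (x - w)\<^sup>2" by algebra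
    then show ?thesis by (smt (verit) zero_le_power2)
  qed
  then have "ln ((1 + x * w)\<^sup>2) \<le> ln ((1 + x\<^sup>2) * (1 + w\<^sup>2))"
    using assms by (subst ln_le_cancel_iff) (auto intro!: mult_pos_pos one_plus_sq_pos)
  then have "2 * ln (1 + x * w) \<le> ln (1 + x\<^sup>2) + ln (1 + w\<^sup>2)"
    using assms one_plus_sq_pos[of x] one_plus_sq_pos[of w] by (simp add: ln_mult ln_realpow)
  then show ?thesis by (simp add: energy_def rest_energy_def field_simps)
qed

text \<open>The numerator over the common denominator is x (p \<mu> - p - 1 - \<mu> x^2), and \<mu>
  x0^2 = p \<mu> - p - 1. So on the positive half line there is a single hump, with its top at
  \<open>x0\<close>.\<close>

lemma rest_energy_deriv:
  "(rest_energy has_real_derivative \<mu> * x * (x0\<^sup>2 - x\<^sup>2) / ((1 + \<mu> * x\<^sup>2) * (1 + x\<^sup>2))) (at x)"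
proof -
  have ln: "((\<lambda>x. ln (1 + c * x\<^sup>2)) has_real_derivative 2 * c * x / (1 + c * x\<^sup>2)) (at x)" if "c > 0" for c
  proof -
    have "1 + c * x\<^sup>2 > 0" using that by (simp add: add_pos_nonneg)
    then show ?thesis by (auto intro!: derivative_eq_intros)
  qed
  have d: "(rest_energy has_real_derivative real p / 2 * (2 * \<mu> * x / (1 + \<mu> * x\<^sup>2))
      - (real p + 1) / 2 * (2 * 1 * x / (1 + 1 * x\<^sup>2))) (at x)"
    using DERIV_diff[OF DERIV_cmult[OF ln] DERIV_cmult[OF ln], of \<mu> 1 "real p / 2" "(real p + 1) / 2"] mu_gt_1
    by (simp add: rest_energy_def[abs_def])
  define D where "D = 1 + \<mu> * x\<^sup>2"
  have nz: "D \<noteq> 0" "1 + x\<^sup>2 \<noteq> 0" using denom_pos(3) one_plus_sq_pos[of x] by (auto simp: D_def)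
  have e: "\<mu> * x * (x0\<^sup>2 - x\<^sup>2) = real p * (\<mu> * x) * (1 + x\<^sup>2) - (real p + 1) * x * D"
    using mu_x0_sq unfolding D_def by algebra
  have "real p / 2 * (2 * \<mu> * x / D) - (real p + 1) / 2 * (2 * 1 * x / (1 + 1 * x\<^sup>2))
      = real p * (\<mu> * x) / D - (real p + 1) * x / (1 + x\<^sup>2)"
    by simp
  also have "\<dots> = \<mu> * x * (x0\<^sup>2 - x\<^sup>2) / (D * (1 + x\<^sup>2))"
    unfolding e by (rule diff_frac_eq[OF nz])
  finally show ?thesis using d by (simp add: D_def)
qed

lemma rest_energy_increasing:
  assumes "0 \<le> a" "a < b" "b \<le> x0"
  shows "rest_energy a < rest_energy b"
proof (rule DERIV_pos_imp_increasing_open[OF assms(2)])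
  fix y assume y: "a < y" "y < b"
  have "y\<^sup>2 < x0\<^sup>2" by (rule power_strict_mono) (use y assms in auto)
  then have "\<mu> * y * (x0\<^sup>2 - y\<^sup>2) / ((1 + \<mu> * y\<^sup>2) * (1 + y\<^sup>2)) > 0"
    using y assms mu_gt_1 denom_pos(1)[of y] one_plus_sq_pos[of y] by (intro divide_pos_pos mult_pos_pos) auto
  then show "\<exists>z. (rest_energy has_real_derivative z) (at y) \<and> z > 0" using rest_energy_deriv by blast
qed (meson DERIV_isCont continuous_at_imp_continuous_on rest_energy_deriv)

lemma rest_energy_decreasing:
  assumes "x0 \<le> a" "a < b"
  shows "rest_energy b < rest_energy a"
proof (rule DERIV_neg_imp_decreasing_open[OF assms(2)])
  fix y assume y: "a < y" "y < b"
  have "x0\<^sup>2 < y\<^sup>2" by (rule power_strict_mono) (use y assms x0_pos in auto)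
  moreover have "y > 0" using y assms x0_pos by simp
  ultimately have "\<mu> * y * (x0\<^sup>2 - y\<^sup>2) / ((1 + \<mu> * y\<^sup>2) * (1 + y\<^sup>2)) < 0"
    using mu_gt_1 denom_pos(1)[of y] one_plus_sq_pos[of y]
    by (intro divide_neg_pos mult_pos_neg mult_pos_pos) auto
  then show "\<exists>z. (rest_energy has_real_derivative z) (at y) \<and> z < 0" using rest_energy_deriv by blast
qed (meson DERIV_isCont continuous_at_imp_continuous_on rest_energy_deriv)

lemma rest_energy_max:
  assumes "x \<ge> 0"
  shows "rest_energy x \<le> rest_energy x0"
  using rest_energy_increasing[of x x0] rest_energy_decreasing[of x0 x] assms
  by (cases x x0 rule: linorder_cases) auto

text \<open>The rest energy vanishes at the origin, so a positive energy keeps an orbit away from it.\<close>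
lemma rest_energy_le: "rest_energy x \<le> bnd / 2 * x\<^sup>2"
proof -
  have "ln (1 + \<mu> * x\<^sup>2) \<le> \<mu> * x\<^sup>2" by (rule ln_add_one_self_le_self) (use mu_gt_1 in simp)
  then have "real p / 2 * ln (1 + \<mu> * x\<^sup>2) \<le> real p / 2 * (\<mu> * x\<^sup>2)" by (intro mult_left_mono) auto
  moreover have "(real p + 1) / 2 * ln (1 + x\<^sup>2) \<ge> 0" by simp
  moreover have "bnd / 2 * x\<^sup>2 = real p / 2 * (\<mu> * x\<^sup>2)" by (simp add: bnd_def)
  ultimately show ?thesis unfolding rest_energy_def by linarith
qed

text \<open>The factor 1 + w^2 of \<open>accel\<close> cancels, leaving a common factor w - x. The
  terms with \<mu> then collapse to (p + 2) w / (1 + x w), whose coefficient matches that of x / (1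
  + x^2); the difference of these two fractions yields a second factor w - x, hence a
  square.\<close>

lemma energy_rate:
  assumes "1 + x * w > 0"
  shows "((w - x) * w + x * accel x w) / (1 + x * w) - w * accel x w / (1 + w\<^sup>2)
      + real p * (\<mu> * x * (w - x) / (1 + \<mu> * x\<^sup>2)) - (real p + 2) * (x * (w - x) / (1 + x\<^sup>2))
    = (real p + 2) * (w - x)\<^sup>2 / ((1 + x * w) * (1 + x\<^sup>2))"
proof -
  define D where "D = 1 + \<mu> * x\<^sup>2"
  define g where "g = (1 + real p / D) * w - real p * \<mu> * x / D"
  have nz: "D \<noteq> 0" "1 + x\<^sup>2 \<noteq> 0" "1 + w\<^sup>2 \<noteq> 0" "1 + x * w \<noteq> 0"
    using denom_pos(3) one_plus_sq_pos[of x] one_plus_sq_pos[of w] assms by (auto simp: D_def)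
  have acc: "accel x w = - (1 + w\<^sup>2) * g" by (simp add: accel_def g_def D_def)
  have 1: "((w - x) * w + x * accel x w) / (1 + x * w) - w * accel x w / (1 + w\<^sup>2) = (w - x) * (w + g) / (1 + x * w)"
    unfolding acc using nz(3,4) by (simp add: divide_simps) algebra
  have Dg: "D * g = (D + real p) * w - real p * \<mu> * x"
    using nz(1) by (simp add: g_def field_simps)
  have 2: "(w + g) / (1 + x * w) + real p * (\<mu> * x) / D = (real p + 2) * w / (1 + x * w)"
  proof -
    have "D * (w + g) + real p * (\<mu> * x) * (1 + x * w) = (real p + 2) * w * D"
      using Dg unfolding D_def by algebra
    then have "(w + g) * D + real p * (\<mu> * x) * (1 + x * w) = (real p + 2) * w * D"
      by (simp add: mult.commute)
    then show ?thesis using nz(1,4) by (simp add: add_frac_eq)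
  qed
  have 3: "(real p + 2) * w / (1 + x * w) - (real p + 2) * x / (1 + x\<^sup>2) = (real p + 2) * (w - x) / ((1 + x * w) * (1 + x\<^sup>2))"
    using nz(2,4) by (simp add: divide_simps) algebra
  have "(w - x) * (w + g) / (1 + x * w) + real p * (\<mu> * x * (w - x) / D) - (real p + 2) * (x * (w - x) / (1 + x\<^sup>2))
      = (w - x) * (((w + g) / (1 + x * w) + real p * (\<mu> * x) / D) - (real p + 2) * x / (1 + x\<^sup>2))"
    by (simp add: right_diff_distrib distrib_left mult_ac)
  also have "\<dots> = (real p + 2) * (w - x)\<^sup>2 / ((1 + x * w) * (1 + x\<^sup>2))"
    unfolding 2 3 by (simp add: power2_eq_square)
  finally show ?thesis unfolding 1 D_def .
qed

end

section \<open>Convergence to the equilibrium\<close>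

text \<open>The last assumption says damping^2 < 4 stiffness at the equilibrium, cleared of the
  denominator \<open>bnd\<close>: there the damping is p + 2 and the stiffness is 2 (p + 1) (bnd -
  (p + 1)) / bnd.\<close>

locale cone_orbit = cone_ode +
  fixes x w :: "real \<Rightarrow> real" and t0 :: real
  assumes dx: "(x has_real_derivative w t - x t) (at t)"
    and dw: "(w has_real_derivative accel (x t) (w t)) (at t)"
    and x_pos: "0 < x t" and x_less: "x t < bnd" and w_pos: "0 < w t" and w_less: "w t < bnd"
    and early: "t \<le> t0 \<Longrightarrow> x t < w t"
    and x_lim: "(x \<longlongrightarrow> 0) at_bot" and w_lim: "(w \<longlongrightarrow> 0) at_bot"
    and discriminant: "(real p + 2)\<^sup>2 * bnd < 8 * (real p + 1) * (bnd - (real p + 1))"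
begin

section \<open>Energy balance along the orbit\<close>

definition vel :: "real \<Rightarrow> real" where "vel t = w t - x t"

definition dmp :: "real \<Rightarrow> real" where "dmp t = damping (x t) (w t)"

definition stf :: "real \<Rightarrow> real" where "stf t = stiffness (x t) (w t)"

definition en :: "real \<Rightarrow> real" where "en t = energy (x t) (w t)"

definition rate :: "real \<Rightarrow> real" where
  "rate t = (real p + 2) * (vel t)\<^sup>2 / ((1 + x t * w t) * (1 + (x t)\<^sup>2))"

lemma x_deriv_vel: "(x has_real_derivative vel t) (at t)"
  using dx by (simp add: vel_def)

lemma vel_deriv: "(vel has_real_derivative - dmp t * vel t + stf t * (x0 - x t)) (at t)"
  unfolding dmp_def stf_def vel_def[abs_def] accel_oscillator[symmetric]
  by (rule DERIV_diff[OF dw dx])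

lemma continuous_orbit: "continuous_on S x" "continuous_on S w" "continuous_on S vel"
  using dx dw vel_deriv by (meson DERIV_isCont continuous_at_imp_continuous_on)+

lemma xw_pos: "1 + x t * w t > 0"
  using x_pos[of t] w_pos[of t] by (simp add: add_pos_pos)

lemma en_deriv: "(en has_real_derivative rate t) (at t)"
proof -
  have d1: "((\<lambda>t. ln (1 + x t * w t)) has_real_derivative ((w t - x t) * w t + x t * accel (x t) (w t)) / (1 + x t * w t)) (at t)"
    by (rule derivative_eq_intros refl dx dw xw_pos
        | simp add: add_divide_distrib diff_divide_distrib algebra_simps)+
  have sq: "((\<lambda>t. ln (1 + c * (f t)\<^sup>2)) has_real_derivative 2 * (c * f t * f' / (1 + c * (f t)\<^sup>2))) (at t)"
    if "(f has_real_derivative f') (at t)" "c > 0" for f f' c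
  proof -
    have "1 + c * (f t)\<^sup>2 > 0" using that by (simp add: add_pos_nonneg)
    then show ?thesis using that by (auto intro!: derivative_eq_intros)
  qed
  have d2: "((\<lambda>t. ln (1 + (w t)\<^sup>2)) has_real_derivative 2 * (w t * accel (x t) (w t) / (1 + (w t)\<^sup>2))) (at t)"
    using sq[OF dw, of 1] by simp
  have d3: "((\<lambda>t. ln (1 + (x t)\<^sup>2)) has_real_derivative 2 * (x t * (w t - x t) / (1 + (x t)\<^sup>2))) (at t)"
    using sq[OF dx, of 1] by simp
  have d4: "((\<lambda>t. ln (1 + \<mu> * (x t)\<^sup>2)) has_real_derivative 2 * (\<mu> * x t * (w t - x t) / (1 + \<mu> * (x t)\<^sup>2))) (at t)"
    using sq[OF dx, of \<mu>] mu_gt_1 by simp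
  have "(en has_real_derivative ((w t - x t) * w t + x t * accel (x t) (w t)) / (1 + x t * w t)
      - 2 * (w t * accel (x t) (w t) / (1 + (w t)\<^sup>2)) / 2
      + real p / 2 * (2 * (\<mu> * x t * (w t - x t) / (1 + \<mu> * (x t)\<^sup>2)))
      - (real p / 2 + 1) * (2 * (x t * (w t - x t) / (1 + (x t)\<^sup>2)))) (at t)"
    unfolding en_def[abs_def] energy_def
    by (intro DERIV_diff DERIV_add DERIV_cmult DERIV_cdivide d1 d2 d3 d4)
  moreover have "2 * a / 2 = a" "real p / 2 * (2 * a) = real p * a" "(real p / 2 + 1) * (2 * a) = (real p + 2) * a"
    for a :: real by (simp_all add: distrib_right)
  ultimately show ?thesis
    unfolding rate_def vel_def energy_rate[OF xw_pos, symmetric] by (simp only:)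
qed

lemma rate_lower: "rate t \<ge> 1 / (1 + bnd\<^sup>2)\<^sup>2 * (vel t)\<^sup>2"
proof -
  have "(1 + x t * w t) * (1 + (x t)\<^sup>2) \<le> (1 + bnd * bnd) * (1 + bnd\<^sup>2)"
    using x_pos[of t] x_less[of t] w_pos[of t] w_less[of t]
    by (intro mult_mono add_left_mono power_mono) auto
  then have "1 * (vel t)\<^sup>2 / ((1 + bnd * bnd) * (1 + bnd\<^sup>2)) \<le> rate t"
    unfolding rate_def using xw_pos[of t] one_plus_sq_pos[of "x t"]
    by (intro frac_le mult_right_mono mult_pos_pos) auto
  then show ?thesis by (simp add: power2_eq_square)
qed

lemma rate_nonneg: "rate t \<ge> 0" and rate_pos: "vel t \<noteq> 0 \<Longrightarrow> rate t > 0"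
  using xw_pos[of t] one_plus_sq_pos[of "x t"] by (auto simp: rate_def)

lemma en_mono: "s \<le> t \<Longrightarrow> en s \<le> en t"
  by (rule DERIV_nonneg_imp_nondecreasing) (use en_deriv rate_nonneg in blast)+

lemma en_strict_mono:
  assumes "s < t" and "\<And>u. s < u \<Longrightarrow> u < t \<Longrightarrow> vel u \<noteq> 0"
  shows "en s < en t"
proof (rule DERIV_pos_imp_increasing_open[OF assms(1)])
  show "\<exists>y. (en has_real_derivative y) (at u) \<and> 0 < y" if "s < u" "u < t" for u
    using en_deriv rate_pos[OF assms(2)[OF that]] by blast
  show "continuous_on {s..t} en"
    using en_deriv by (meson DERIV_isCont continuous_at_imp_continuous_on)
qed

lemma en_nonneg: "en t \<ge> 0"
proof -
  have "((\<lambda>t. en t) \<longlongrightarrow> energy 0 0) at_bot"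
    unfolding en_def energy_def
    by (intro tendsto_intros x_lim w_lim) auto
  then have "(en \<longlongrightarrow> 0) at_bot" by (simp add: energy_def)
  then show ?thesis
    by (rule tendsto_upperbound) (auto simp: eventually_at_bot_linorder intro!: exI[of _ t] en_mono)
qed

text \<open>The energy tends to 0 at -infinity and increases strictly while the velocity is
  positive. This keeps the orbit from returning to the saddle.\<close>

lemma en_pos: "en t > 0"
proof -
  define s where "s = min t t0"
  have "en (s - 1) < en s"
  proof (rule en_strict_mono)
    show "vel u \<noteq> 0" if "u < s" for u
      using early[of u] that by (simp add: s_def vel_def)
  qed simp
  moreover have "en s \<le> en t" by (rule en_mono) (simp add: s_def)
  ultimately show ?thesis using en_nonneg[of "s - 1"] by linarith
qed

lemma en_le_rest: "en t \<le> rest_energy (x t)"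
  unfolding en_def by (rule energy_le_rest[OF xw_pos])

lemma en_bounded: "en t \<le> rest_energy x0"
  using en_le_rest[of t] rest_energy_max[of "x t"] x_pos[of t] by simp

lemma en_at_rest: "vel t = 0 \<Longrightarrow> en t = rest_energy (x t)"
  by (simp add: en_def vel_def energy_diag)

lemma coefficient_bounds:
  obtains Pm Qm where "\<And>t. 0 \<le> dmp t" "\<And>t. dmp t \<le> Pm" "\<And>t. 0 < stf t" "\<And>t. stf t \<le> Qm"
proof (rule that)
  fix t
  have b: "0 < x t" "x t < bnd" "0 < w t" "w t < bnd" "0 < x0" "\<mu> > 0"
    using x_pos x_less w_pos w_less x0_pos mu_gt_1 by auto
  have D: "1 + \<mu> * (x t)\<^sup>2 \<ge> 1" by (rule denom_pos)
  have q: "real p / (1 + \<mu> * (x t)\<^sup>2) \<le> real p / 1" by (rule divide_left_mono) (use D in auto)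
  have q0: "0 \<le> real p / (1 + \<mu> * (x t)\<^sup>2)" using D by simp
  show "0 \<le> dmp t" unfolding dmp_def damping_def using q0 by (intro add_nonneg_nonneg mult_nonneg_nonneg) auto
  show "dmp t \<le> 1 + (1 + real p / 1) * (1 + bnd\<^sup>2)"
    unfolding dmp_def damping_def using q q0 b by (intro add_left_mono mult_mono power_mono) auto
  show "0 < stf t" unfolding stf_def stiffness_def using denom_pos(1)[of "x t"] b one_plus_sq_pos[of "w t"]
    by (intro divide_pos_pos mult_pos_pos) auto
  show "stf t \<le> \<mu> * (bnd + x0) * bnd * (1 + bnd\<^sup>2) / 1"
    unfolding stf_def stiffness_def using D b denom_pos(1)[of "x t"]
    by (intro frac_le mult_mono add_left_mono add_right_mono power_mono mult_nonneg_nonneg) auto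
qed

lemma vel_tendsto_0: "(vel \<longlongrightarrow> 0) at_top"
proof -
  obtain Pm Qm where P: "\<And>t. 0 \<le> dmp t" "\<And>t. dmp t \<le> Pm" and Q: "\<And>t. 0 < stf t" "\<And>t. stf t \<le> Qm"
    using coefficient_bounds by metis
  show ?thesis
  proof (rule tendsto_zero_by_dissipation[where a = 0 and F = en and F' = rate and f = vel
        and c = "1 / (1 + bnd\<^sup>2)\<^sup>2" and M = "rest_energy x0"])
    show "(en has_real_derivative rate t) (at t)" for t by (rule en_deriv)
    show "(vel has_real_derivative - dmp t * vel t + stf t * (x0 - x t)) (at t)" for t by (rule vel_deriv)
    show "1 / (1 + bnd\<^sup>2)\<^sup>2 * (vel t)\<^sup>2 \<le> rate t" for t by (rule rate_lower)
    show "0 < 1 / (1 + bnd\<^sup>2)\<^sup>2" using one_plus_sq_pos[of bnd] by simp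
    show "en t \<le> rest_energy x0" for t by (rule en_bounded)
    show "\<bar>- dmp t * vel t + stf t * (x0 - x t)\<bar> \<le> Pm * bnd + Qm * (bnd + x0)" for t
    proof -
      have "\<bar>vel t\<bar> \<le> bnd" "\<bar>x0 - x t\<bar> \<le> bnd + x0"
        using x_pos[of t] x_less[of t] w_pos[of t] w_less[of t] x0_pos unfolding vel_def by linarith+
      then have "\<bar>dmp t * vel t\<bar> \<le> Pm * bnd" "\<bar>stf t * (x0 - x t)\<bar> \<le> Qm * (bnd + x0)"
        unfolding abs_mult using P[of t] Q[of t] by (auto intro!: mult_mono)
      then show ?thesis by linarith
    qed
  qed
qed

lemma x_lower_bound:
  obtains \<delta> where "\<delta> > 0" and "\<And>t. t \<ge> 0 \<Longrightarrow> x t \<ge> \<delta>"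
proof
  show "sqrt (2 * en 0 / bnd) > 0" using en_pos[of 0] bnd_pos by simp
  fix t :: real assume "t \<ge> 0"
  then have "en 0 \<le> en t" by (rule en_mono)
  also have "\<dots> \<le> bnd / 2 * (x t)\<^sup>2" using en_le_rest[of t] rest_energy_le[of "x t"] by linarith
  finally have "2 * en 0 / bnd \<le> (x t)\<^sup>2" using bnd_pos by (simp add: field_simps)
  then show "sqrt (2 * en 0 / bnd) \<le> x t" using x_pos[of t] by (simp add: real_le_lsqrt)
qed

text \<open>The energy dissipates only through \<open>vel\<close>. Adding the cross term
  \<open>vel * (x0 - x)\<close> brings in \<open>stf * (x0 - x)\<close>^2, and a large multiple of
  the energy absorbs the terms that contain \<open>vel\<close>. The stiffness degenerates at x = 0,
  which is why a lower bound on \<open>x\<close> is needed first.\<close>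

lemma x_tendsto: "(x \<longlongrightarrow> x0) at_top"
proof -
  obtain Pm Qm where P: "\<And>t. 0 \<le> dmp t" "\<And>t. dmp t \<le> Pm" and Q: "\<And>t. 0 < stf t" "\<And>t. stf t \<le> Qm"
    using coefficient_bounds by metis
  obtain \<delta> where \<delta>: "\<delta> > 0" "\<And>t. t \<ge> 0 \<Longrightarrow> x t \<ge> \<delta>" using x_lower_bound by blast
  define q where "q = \<mu> * x0 * \<delta> * 1 / (1 + \<mu> * bnd\<^sup>2)"
  have mu0: "\<mu> > 0" using mu_gt_1 by simp
  have q: "q > 0" unfolding q_def using mu0 x0_pos \<delta> denom_pos(1)[of bnd] by simp
  have Qq: "stf t \<ge> q" if "t \<ge> 0" for t
  proof -
    have "x t > 0" "x t < bnd" "x t \<ge> \<delta>" using x_pos x_less \<delta>(2)[OF that] by auto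
    then show ?thesis
      unfolding q_def stf_def stiffness_def using mu0 x0_pos \<delta>(1) denom_pos(1)[of "x t"]
      by (intro frac_le mult_mono add_left_mono power_mono) (auto intro!: mult_nonneg_nonneg)
  qed
  define c where "c = 1 / (1 + bnd\<^sup>2)\<^sup>2"
  have c: "c > 0" using one_plus_sq_pos[of bnd] by (simp add: c_def)
  \<comment> \<open>Times \<open>c\<close>, the first summand pays for the damping term after
    Young's inequality, and the 1 for the square of \<open>vel\<close>.\<close>
  define C where "C = (Pm\<^sup>2 / (2 * q) + 1) / c"
  have C: "C > 0" unfolding C_def using c q by (intro divide_pos_pos add_nonneg_pos) auto
  have "((\<lambda>t. x0 - x t) \<longlongrightarrow> 0) at_top"
  proof (rule tendsto_zero_by_dissipation[where a = 0 and F = "\<lambda>t. C * en t + vel t * (x0 - x t)"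
        and c = "q / 2" and K = bnd and f' = "\<lambda>t. - vel t"])
    show "((\<lambda>t. C * en t + vel t * (x0 - x t)) has_real_derivative
        C * rate t + ((- dmp t * vel t + stf t * (x0 - x t)) * (x0 - x t) + (0 - vel t) * vel t)) (at t)" for t
      by (intro DERIV_add DERIV_cmult en_deriv DERIV_mult vel_deriv DERIV_diff DERIV_const x_deriv_vel)
    show "((\<lambda>t. x0 - x t) has_real_derivative - vel t) (at t)" for t
      by (auto intro!: derivative_eq_intros x_deriv_vel)
    show "q / 2 * (x0 - x t)\<^sup>2 \<le> C * rate t + ((- dmp t * vel t + stf t * (x0 - x t)) * (x0 - x t) + (0 - vel t) * vel t)"
      if "t \<ge> 0" for t
    proof -
      define y where "y = x0 - x t"
      define v where "v = vel t"
      have "(dmp t)\<^sup>2 \<le> Pm\<^sup>2" using P[of t] by (intro power_mono) auto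
      have "C * rate t \<ge> C * (c * v\<^sup>2)"
        using rate_lower[of t] C by (intro mult_left_mono) (auto simp: c_def v_def)
      also have "C * (c * v\<^sup>2) = (Pm\<^sup>2 / (2 * q) + 1) * v\<^sup>2" using c by (simp add: C_def)
      finally have 1: "C * rate t \<ge> Pm\<^sup>2 / (2 * q) * v\<^sup>2 + v\<^sup>2" by (simp add: distrib_right)
      have "(dmp t)\<^sup>2 / (2 * q) * v\<^sup>2 \<le> Pm\<^sup>2 / (2 * q) * v\<^sup>2"
        using \<open>(dmp t)\<^sup>2 \<le> Pm\<^sup>2\<close> q by (intro mult_right_mono divide_right_mono) auto
      moreover have "dmp t * v * y \<le> (dmp t)\<^sup>2 / (2 * q) * v\<^sup>2 + q / 2 * y\<^sup>2"
      proof -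
        have "0 \<le> (dmp t * v - q * y)\<^sup>2 / (2 * q)" using q by simp
        also have "\<dots> = (dmp t)\<^sup>2 / (2 * q) * v\<^sup>2 + q / 2 * y\<^sup>2 - dmp t * v * y"
          using q by (simp add: power2_eq_square field_simps)
        finally show ?thesis by simp
      qed
      moreover have "stf t * y\<^sup>2 \<ge> q * y\<^sup>2" using Qq[OF that] by (intro mult_right_mono) auto
      ultimately have "q / 2 * y\<^sup>2 \<le> C * rate t - dmp t * v * y + stf t * y\<^sup>2 - v\<^sup>2"
        using 1 by (simp add: field_simps)
      also have "\<dots> = C * rate t + ((- dmp t * v + stf t * y) * y + (0 - v) * v)"
        by (simp add: power2_eq_square algebra_simps)
      finally show ?thesis by (simp only: y_def v_def)
    qed
    show "C * en t + vel t * (x0 - x t) \<le> C * rest_energy x0 + bnd * (bnd + x0)" for t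
    proof -
      have "\<bar>vel t\<bar> \<le> bnd" "\<bar>x0 - x t\<bar> \<le> bnd + x0"
        using x_pos[of t] x_less[of t] w_pos[of t] w_less[of t] x0_pos unfolding vel_def by linarith+
      then have "\<bar>vel t * (x0 - x t)\<bar> \<le> bnd * (bnd + x0)"
        unfolding abs_mult using bnd_pos by (intro mult_mono) auto
      moreover have "C * en t \<le> C * rest_energy x0" using en_bounded C by simp
      ultimately show ?thesis by linarith
    qed
    show "\<bar>- vel t\<bar> \<le> bnd" for t
      using x_pos[of t] x_less[of t] w_pos[of t] w_less[of t] unfolding vel_def by linarith
  qed (use q in auto)
  from tendsto_diff[OF tendsto_const[of x0] this] show ?thesis by simp
qed

lemma w_tendsto: "(w \<longlongrightarrow> x0) at_top"
  using tendsto_add[OF vel_tendsto_0 x_tendsto] by (simp add: vel_def[abs_def])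

text \<open>Backward uniqueness: the squared distance E to the equilibrium satisfies E' >= - K E, so
  exp (K s) E s is nondecreasing. A zero of E would spread back to the initial phase, where the
  velocity is positive.\<close>

lemma not_at_equilibrium:
  assumes "vel t = 0"
  shows "x t \<noteq> x0"
proof
  assume xt: "x t = x0"
  obtain Pm Qm where P: "\<And>t. 0 \<le> dmp t" "\<And>t. dmp t \<le> Pm" and Q: "\<And>t. 0 < stf t" "\<And>t. stf t \<le> Qm"
    using coefficient_bounds by metis
  define K where "K = 2 * Pm + 1 + Qm"
  define E where "E s = (vel s)\<^sup>2 + (x0 - x s)\<^sup>2" for s
  define E' where "E' s = 2 * vel s * (- dmp s * vel s + stf s * (x0 - x s)) + 2 * (x0 - x s) * (0 - vel s)" for s
  have dE: "(E has_real_derivative E' s) (at s)" for s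
    unfolding E_def[abs_def] E'_def
    by (rule derivative_eq_intros vel_deriv x_deriv_vel refl | simp add: algebra_simps)+
  have EE: "E' s \<ge> - K * E s" for s
  proof -
    define v y where "v = vel s" and "y = x0 - x s"
    have b: "2 * \<bar>v * y\<bar> \<le> v\<^sup>2 + y\<^sup>2"
      using zero_le_power2[of "\<bar>v\<bar> - \<bar>y\<bar>"] by (simp add: power2_diff abs_mult)
    have "\<bar>2 * (stf s - 1) * (v * y)\<bar> \<le> (Qm + 1) * (2 * \<bar>v * y\<bar>)"
    proof -
      have "\<bar>stf s - 1\<bar> \<le> Qm + 1" using Q[of s] by linarith
      then have "\<bar>stf s - 1\<bar> * (2 * \<bar>v * y\<bar>) \<le> (Qm + 1) * (2 * \<bar>v * y\<bar>)" by (intro mult_right_mono) auto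
      then show ?thesis by (simp only: abs_mult abs_numeral mult_ac)
    qed
    also have "\<dots> \<le> (Qm + 1) * (v\<^sup>2 + y\<^sup>2)" using b Q[of s] by (intro mult_left_mono) auto
    finally have 1: "2 * (stf s - 1) * (v * y) \<ge> - ((Qm + 1) * (v\<^sup>2 + y\<^sup>2))" by linarith
    have "dmp s * v\<^sup>2 \<le> Pm * (v\<^sup>2 + y\<^sup>2)" using P[of s] by (intro mult_mono) auto
    with 1 have "2 * (stf s - 1) * (v * y) - 2 * (dmp s * v\<^sup>2) \<ge> - ((Qm + 1) * (v\<^sup>2 + y\<^sup>2)) - 2 * (Pm * (v\<^sup>2 + y\<^sup>2))"
      by linarith
    moreover have "E' s = 2 * (stf s - 1) * (v * y) - 2 * (dmp s * v\<^sup>2)"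
      unfolding E'_def v_def[symmetric] y_def[symmetric] by algebra
    moreover have "- K * E s = - ((Qm + 1) * (v\<^sup>2 + y\<^sup>2)) - 2 * (Pm * (v\<^sup>2 + y\<^sup>2))"
      unfolding E_def v_def[symmetric] y_def[symmetric] K_def by algebra
    ultimately show ?thesis by simp
  qed
  define s where "s = min t t0"
  have "exp (K * s) * E s \<le> exp (K * t) * E t"
  proof (rule DERIV_nonneg_imp_nondecreasing[of s t "\<lambda>u. exp (K * u) * E u"])
    fix u
    have "((\<lambda>u. exp (K * u) * E u) has_real_derivative exp (K * u) * (K * E u + E' u)) (at u)"
      by (rule derivative_eq_intros dE refl | simp add: algebra_simps)+
    moreover have "exp (K * u) * (K * E u + E' u) \<ge> 0" using EE[of u] by simp
    ultimately show "\<exists>y. ((\<lambda>u. exp (K * u) * E u) has_real_derivative y) (at u) \<and> 0 \<le> y" by blast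
  qed (simp add: s_def)
  also have "E t = 0" using assms xt by (simp add: E_def)
  finally have "E s \<le> 0" by (simp add: mult_le_0_iff)
  moreover have "vel s > 0" using early[of s] by (simp add: s_def vel_def)
  then have "E s > 0" unfolding E_def by (intro add_pos_nonneg) auto
  ultimately show False by simp
qed

end

section \<open>Spiralling and turning times\<close>

context cone_orbit
begin

lemma discriminant_limits:
  "damping x0 x0 = real p + 2"
  "4 * stiffness x0 x0 > (real p + 2)\<^sup>2"
proof -
  have nz: "\<mu> \<noteq> 0" "\<mu> - 1 \<noteq> 0" "real p \<noteq> 0" using mu_gt_1 p1 by auto
  have sq: "1 + x0\<^sup>2 = (real p + 1) * (\<mu> - 1) / \<mu>"
    unfolding x0_sq using nz by (simp add: field_simps)
  show "damping x0 x0 = real p + 2"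
    unfolding damping_def mu_x0_sq sq using nz by (simp add: field_simps)
  have "stiffness x0 x0 = 2 * \<mu> * x0\<^sup>2 * (1 + x0\<^sup>2) / (1 + \<mu> * x0\<^sup>2)"
    by (simp add: stiffness_def power2_eq_square)
  also have "\<dots> = 2 * \<mu> * x0\<^sup>2 * ((real p + 1) * (\<mu> - 1) / \<mu>) / (real p * (\<mu> - 1))"
    unfolding mu_x0_sq sq ..
  also have "\<dots> = 2 * (real p + 1) * x0\<^sup>2 / real p" using nz by (simp add: field_simps)
  also have "\<dots> = 2 * (real p + 1) * (bnd - (real p + 1)) / bnd"
    unfolding x0_sq bnd_def using nz by (simp add: field_simps)
  finally have "bnd * (4 * stiffness x0 x0) = 8 * (real p + 1) * (bnd - (real p + 1))"
    using bnd_pos by simp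
  then have "bnd * (real p + 2)\<^sup>2 < bnd * (4 * stiffness x0 x0)"
    using discriminant by (simp only: mult.commute[of bnd])
  then show "4 * stiffness x0 x0 > (real p + 2)\<^sup>2"
    using bnd_pos by simp
qed

text \<open>The strict discriminant inequality survives the subtraction of a small d (1 + z^2) and
  the passage from the limit coefficients to those at large t. Completing the square then makes it
  uniform in z.\<close>

lemma oscillation_margin:
  obtains d T where "d > 0" and "\<And>t z. t \<ge> T \<Longrightarrow> z\<^sup>2 - dmp t * z + stf t \<ge> d * (1 + z\<^sup>2)"
proof -
  have P: "(dmp \<longlongrightarrow> damping x0 x0) at_top"
    unfolding dmp_def[abs_def] damping_def
    by (intro tendsto_intros x_tendsto w_tendsto denom_pos(3))
  have Q: "(stf \<longlongrightarrow> stiffness x0 x0) at_top"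
    unfolding stf_def[abs_def] stiffness_def
    by (intro tendsto_intros x_tendsto w_tendsto denom_pos(3))
  have "((\<lambda>d. 4 * (1 - d) * (stiffness x0 x0 - d)) \<longlongrightarrow> 4 * (1 - 0) * (stiffness x0 x0 - 0)) (at_right 0)"
    by (intro tendsto_intros)
  then have "\<forall>\<^sub>F d in at_right 0. 4 * (1 - d) * (stiffness x0 x0 - d) > (real p + 2)\<^sup>2"
    by (rule order_tendstoD(1)) (use discriminant_limits(2) in simp)
  moreover have "\<forall>\<^sub>F d in at_right (0::real). 0 < d \<and> d < 1"
    by (auto simp: eventually_at_right_field intro!: exI[of _ 1])
  ultimately have "\<forall>\<^sub>F d in at_right 0. 4 * (1 - d) * (stiffness x0 x0 - d) > (real p + 2)\<^sup>2 \<and> 0 < d \<and> d < 1"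
    by eventually_elim simp
  then obtain d where d: "0 < d" "d < 1" "4 * (1 - d) * (stiffness x0 x0 - d) > (real p + 2)\<^sup>2"
    by (auto dest!: eventually_happens)
  have "((\<lambda>t. 4 * (1 - d) * (stf t - d) - (dmp t)\<^sup>2) \<longlongrightarrow>
      4 * (1 - d) * (stiffness x0 x0 - d) - (damping x0 x0)\<^sup>2) at_top"
    by (intro tendsto_intros P Q)
  then have "\<forall>\<^sub>F t in at_top. 4 * (1 - d) * (stf t - d) - (dmp t)\<^sup>2 > 0"
    by (rule order_tendstoD(1)) (use d discriminant_limits(1) in simp)
  then obtain T where T: "\<And>t. t \<ge> T \<Longrightarrow> 4 * (1 - d) * (stf t - d) - (dmp t)\<^sup>2 > 0"
    by (auto simp: eventually_at_top_linorder)
  show thesis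
  proof (rule that[OF d(1)])
    fix t z assume "t \<ge> T"
    have "4 * (1 - d) * (z\<^sup>2 - dmp t * z + stf t - d * (1 + z\<^sup>2))
        = (2 * (1 - d) * z - dmp t)\<^sup>2 + (4 * (1 - d) * (stf t - d) - (dmp t)\<^sup>2)"
      by algebra
    also have "\<dots> > 0" using T[OF \<open>t \<ge> T\<close>] by (intro add_nonneg_pos) auto
    finally have "z\<^sup>2 - dmp t * z + stf t - d * (1 + z\<^sup>2) > 0"
      using d by (simp add: zero_less_mult_iff)
    then show "d * (1 + z\<^sup>2) \<le> z\<^sup>2 - dmp t * z + stf t" by simp
  qed
qed

text \<open>If the velocity kept its sign, \<open>z = vel / (x0 - x)\<close> would solve the Riccati equation
  \<open>z' = z\<^sup>2 - dmp z + stf\<close> for all large times, whose right-hand side is bounded below by a positive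
  multiple of \<open>1 + z\<^sup>2\<close>; then \<open>arctan z\<close> would be unbounded.\<close>
lemma velocity_vanishes_later: "\<exists>t>a. vel t = 0"
proof (rule ccontr)
  assume "\<not> (\<exists>t>a. vel t = 0)"
  then have nz: "vel t \<noteq> 0" if "t > a" for t using that by blast
  \<comment> \<open>Without zeros of the velocity \<open>x\<close> is strictly monotone and
    converges to \<open>x0\<close>, so it never attains \<open>x0\<close>, and the quotient below is
    defined.\<close>
  have ne: "x t \<noteq> x0" if t: "t > a" for t
  proof (cases "vel t > 0")
    case True
    have pos: "vel s > 0" if "s > a" for s
      by (rule sign_constant_on_interval[of vel "{a<..}" t])
        (use continuous_orbit nz that t True in auto)
    have incr: "x r < x s" if "t \<le> r" "r < s" for r s
      by (rule DERIV_pos_imp_increasing_open[OF that(2)])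
        (use x_deriv_vel pos that t continuous_orbit in \<open>meson le_less_trans less_trans\<close>)+
    have "x (t + 1) \<le> x0"
      by (rule tendsto_lowerbound[OF x_tendsto])
        (auto simp: eventually_at_top_linorder intro!: exI[of _ "t + 2"] less_imp_le incr)
    then show ?thesis using incr[of t "t + 1"] by simp
  next
    case False
    have neg: "vel s < 0" if "s > a" for s
      using sign_constant_on_interval[of vel "{a<..}" s t] continuous_orbit nz that t False
      by (cases "vel s" "0::real" rule: linorder_cases) auto
    have decr: "x s < x r" if "t \<le> r" "r < s" for r s
      by (rule DERIV_neg_imp_decreasing_open[OF that(2)])
        (use x_deriv_vel neg that t continuous_orbit in \<open>meson le_less_trans less_trans\<close>)+
    have "x (t + 1) \<ge> x0"
      by (rule tendsto_upperbound[OF x_tendsto])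
        (auto simp: eventually_at_top_linorder intro!: exI[of _ "t + 2"] less_imp_le decr)
    then show ?thesis using decr[of t "t + 1"] by simp
  qed
  obtain d T where d: "d > 0"
    and margin: "\<And>t z. t \<ge> T \<Longrightarrow> z\<^sup>2 - dmp t * z + stf t \<ge> d * (1 + z\<^sup>2)"
    using oscillation_margin by metis
  define z where "z t = vel t / (x0 - x t)" for t
  define b where "b = max T (a + 1)"
  have dz: "(z has_real_derivative (z t)\<^sup>2 - dmp t * z t + stf t) (at t)" if "t \<ge> b" for t
  proof -
    have y: "x0 - x t \<noteq> 0" using ne[of t] that by (simp add: b_def)
    have "(z has_real_derivative ((- dmp t * vel t + stf t * (x0 - x t)) * (x0 - x t) - vel t * (0 - vel t))
        / ((x0 - x t) * (x0 - x t))) (at t)"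
      unfolding z_def[abs_def]
      by (intro DERIV_divide vel_deriv DERIV_diff DERIV_const x_deriv_vel y)
    moreover have quot: "((- P * v + S * y) * y - v * (0 - v)) / (y * y) = (v / y)\<^sup>2 - P * (v / y) + S"
      if "y \<noteq> 0" for P v S y :: real
      using that by (simp add: field_simps power2_eq_square)
    ultimately show ?thesis unfolding z_def[of t] by (simp only: quot[OF y])
  qed
  \<comment> \<open>Over this length \<open>arctan\<close> of the quotient would grow by at least 4,
    more than the width pi of its range.\<close>
  define e where "e = b + 4 / d"
  have "b < e" using d by (simp add: e_def)
  have "arctan (z b) - d * b \<le> arctan (z e) - d * e"
  proof (rule DERIV_nonneg_imp_nondecreasing[of b e "\<lambda>t. arctan (z t) - d * t"])
    fix t assume "b \<le> t" "t \<le> e"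
    let ?D = "(z t)\<^sup>2 - dmp t * z t + stf t"
    have "((\<lambda>t. arctan (z t) - d * t) has_real_derivative inverse (1 + (z t)\<^sup>2) * ?D - d * 1) (at t)"
      by (intro DERIV_diff DERIV_cmult DERIV_ident DERIV_chain2[OF DERIV_arctan] dz \<open>b \<le> t\<close>)
    moreover have "inverse (1 + (z t)\<^sup>2) * ?D - d * 1 \<ge> 0"
      using margin[of t "z t"] \<open>b \<le> t\<close> one_plus_sq_pos[of "z t"] by (simp add: b_def field_simps)
    ultimately show "\<exists>y. ((\<lambda>t. arctan (z t) - d * t) has_real_derivative y) (at t) \<and> 0 \<le> y" by blast
  qed (use \<open>b < e\<close> in simp)
  moreover have "d * e = d * b + 4" using d by (simp add: e_def distrib_left)
  ultimately show False
    using arctan_lbound[of "z b"] arctan_ubound[of "z e"] pi_less_4 by linarith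
qed

text \<open>Where the velocity vanishes, only the restoring term is left in its derivative, and it
  is nonzero away from \<open>x0\<close>. All zeros are thus simple, with a crossing direction fixed
  by the side of \<open>x0\<close>.\<close>

lemma velocity_zero_deriv:
  assumes "vel t = 0"
  shows "x t < x0 \<Longrightarrow> \<exists>l>0. (vel has_real_derivative l) (at t)"
    and "x t > x0 \<Longrightarrow> \<exists>l<0. (vel has_real_derivative l) (at t)"
    and "x t < x0 \<or> x t > x0"
proof -
  have stf: "stf t > 0" using coefficient_bounds by metis
  have d: "(vel has_real_derivative stf t * (x0 - x t)) (at t)" using vel_deriv[of t] assms by simp
  show "\<exists>l>0. (vel has_real_derivative l) (at t)" if "x t < x0"
    using d stf that by (intro exI[of _ "stf t * (x0 - x t)"]) auto
  show "\<exists>l<0. (vel has_real_derivative l) (at t)" if "x t > x0"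
    using d stf that by (intro exI[of _ "stf t * (x0 - x t)"]) (auto intro: mult_pos_neg)
  show "x t < x0 \<or> x t > x0" using not_at_equilibrium[OF assms] by linarith
qed

lemma velocity_after_zero:
  assumes "vel t = 0"
  shows "x t < x0 \<Longrightarrow> \<exists>d>0. \<forall>h>0. h < d \<longrightarrow> vel (t + h) > 0 \<and> vel (t - h) < 0"
    and "x t > x0 \<Longrightarrow> \<exists>d>0. \<forall>h>0. h < d \<longrightarrow> vel (t + h) < 0 \<and> vel (t - h) > 0"
proof -
  assume "x t < x0"
  then obtain l where l: "l > 0" "(vel has_real_derivative l) (at t)"
    using velocity_zero_deriv(1)[OF assms] by blast
  obtain d1 d2 where "d1 > 0" "\<And>h. h > 0 \<Longrightarrow> h < d1 \<Longrightarrow> vel t < vel (t + h)"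
    and "d2 > 0" "\<And>h. h > 0 \<Longrightarrow> h < d2 \<Longrightarrow> vel (t - h) < vel t"
    using DERIV_pos_inc_right[OF l(2,1)] DERIV_pos_inc_left[OF l(2,1)] by blast
  then show "\<exists>d>0. \<forall>h>0. h < d \<longrightarrow> vel (t + h) > 0 \<and> vel (t - h) < 0"
    using assms by (intro exI[of _ "min d1 d2"]) auto
next
  assume "x t > x0"
  then obtain l where l: "l < 0" "(vel has_real_derivative l) (at t)"
    using velocity_zero_deriv(2)[OF assms] by blast
  obtain d1 d2 where "d1 > 0" "\<And>h. h > 0 \<Longrightarrow> h < d1 \<Longrightarrow> vel t > vel (t + h)"
    and "d2 > 0" "\<And>h. h > 0 \<Longrightarrow> h < d2 \<Longrightarrow> vel (t - h) > vel t"
    using DERIV_neg_dec_right[OF l(2,1)] DERIV_neg_dec_left[OF l(2,1)] by blast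
  then show "\<exists>d>0. \<forall>h>0. h < d \<longrightarrow> vel (t + h) < 0 \<and> vel (t - h) > 0"
    using assms by (intro exI[of _ "min d1 d2"]) auto
qed

lemma velocity_zeros_isolated: "\<exists>d>0. \<forall>s. s \<noteq> t \<and> \<bar>s - t\<bar> < d \<longrightarrow> vel s \<noteq> 0"
proof (cases "vel t = 0")
  case True
  have "\<exists>d>0. \<forall>h>0. h < d \<longrightarrow> vel (t + h) \<noteq> 0 \<and> vel (t - h) \<noteq> 0"
    using velocity_zero_deriv(3)[OF True] velocity_after_zero[OF True] by (metis less_irrefl)
  then obtain d where d: "d > 0" "\<And>h. h > 0 \<Longrightarrow> h < d \<Longrightarrow> vel (t + h) \<noteq> 0 \<and> vel (t - h) \<noteq> 0" by blast
  have "vel s \<noteq> 0" if "s \<noteq> t" "\<bar>s - t\<bar> < d" for s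
    using d(2)[of "\<bar>s - t\<bar>"] that by (cases "s > t") auto
  with d(1) show ?thesis by blast
next
  case False
  have "isCont vel t" using DERIV_isCont[OF vel_deriv] .
  then have "\<forall>\<^sub>F s in at t. vel s \<noteq> 0"
    using False by (simp add: isCont_def tendsto_imp_eventually_ne)
  then show ?thesis by (auto simp: eventually_at dist_real_def)
qed

lemma next_velocity_zero: "\<exists>b>a. vel b = 0 \<and> (\<forall>t. a < t \<and> t < b \<longrightarrow> vel t \<noteq> 0)"
proof -
  obtain d where d: "d > 0" "\<And>s. s \<noteq> a \<Longrightarrow> \<bar>s - a\<bar> < d \<Longrightarrow> vel s \<noteq> 0"
    using velocity_zeros_isolated by metis
  \<comment> \<open>The shift by d / 2 removes \<open>a\<close>, which may itself be a zero, without
    losing any other.\<close>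
  define S where "S = {t. vel t = 0} \<inter> {a + d / 2..}"
  have "closed S" unfolding S_def
    by (intro closed_Int closed_Collect_eq continuous_orbit continuous_on_const closed_atLeast)
  moreover have "S \<noteq> {}" using velocity_vanishes_later[of "a + d / 2"] by (force simp: S_def)
  moreover have "bdd_below S" by (auto simp: S_def)
  ultimately have b: "Inf S \<in> S" by (intro closed_contains_Inf)
  have "vel t \<noteq> 0" if "a < t" "t < Inf S" for t
  proof (cases "t < a + d / 2")
    case True
    then show ?thesis using d(2)[of t] d(1) that by auto
  next
    case False
    then show ?thesis using cInf_lower[of t S] \<open>bdd_below S\<close> that by (force simp: S_def)
  qed
  then show ?thesis using b d(1) by (intro exI[of _ "Inf S"]) (auto simp: S_def)
qed

lemma turning_times:
  obtains T :: "nat \<Rightarrow> real" where "strict_mono T" and "T 0 = t0"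
    and "\<And>i. i \<ge> 1 \<Longrightarrow> vel (T i) = 0"
    and "\<And>i t. T i < t \<Longrightarrow> t < T (Suc i) \<Longrightarrow> if even i then vel t > 0 else vel t < 0"
    and "\<And>i. i \<ge> 1 \<Longrightarrow> if even i then x (T i) < x0 else x0 < x (T i)"
    and "filterlim T at_top sequentially"
proof -
  obtain nxt where nxt: "\<And>a. a < nxt a" "\<And>a. vel (nxt a) = 0" "\<And>a t. a < t \<Longrightarrow> t < nxt a \<Longrightarrow> vel t \<noteq> 0"
    using next_velocity_zero by metis
  \<comment> \<open>Index 0 is no zero but a marker in the initial phase of positive velocity. So
    \<open>T 1\<close> is the first zero of all, and the parity of the index records the
    sign.\<close>
  define T where "T i = (nxt ^^ i) t0" for i
  have T0: "T 0 = t0" and TS: "\<And>i. T (Suc i) = nxt (T i)" by (auto simp: T_def)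
  have mono: "strict_mono T" by (simp add: strict_mono_Suc_iff TS nxt)
  have zero: "vel (T i) = 0" if "i \<ge> 1" for i
    using that by (cases i) (auto simp: TS nxt)
  have nz: "vel t \<noteq> 0" if "T i < t" "t < T (Suc i)" for i t using nxt(3) that by (simp add: TS)
  have const: "vel t > 0" if "T i < s" "s < T (Suc i)" "vel s > 0" "T i < t" "t < T (Suc i)" for i s t
    by (rule sign_constant_on_interval[of vel "{T i<..<T (Suc i)}" s])
      (use continuous_orbit nz that in auto)
  have sign: "\<forall>t. T i < t \<and> t < T (Suc i) \<longrightarrow> (if even i then vel t > 0 else vel t < 0)" for i
  proof (induction i)
    case 0
    have lt: "T 0 < T (Suc 0)" using mono by (simp add: strict_mono_Suc_iff)
    have v: "vel (T 0) > 0" using early[of t0] by (simp add: T0 vel_def)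
    have "vel t > 0" if "T 0 < t" "t < T (Suc 0)" for t
      by (rule sign_constant_on_interval[of vel "{T 0..<T (Suc 0)}" "T 0"])
        (use continuous_orbit nz that v lt in \<open>auto simp: le_less\<close>)
    then show ?case by auto
  next
    case (Suc i)
    let ?a = "T (Suc i)"
    have a: "vel ?a = 0" by (rule zero) simp
    have lt: "T i < ?a" "?a < T (Suc (Suc i))" using mono by (auto simp: strict_mono_Suc_iff)
    define g where "g = min (?a - T i) (T (Suc (Suc i)) - ?a)"
    have g: "g > 0" using lt by (simp add: g_def)
    show ?case
    proof (cases "even i")
      case True
      \<comment> \<open>The velocity reaches 0 from above here, whereas zeros to the left of
        \<open>x0\<close> are crossed upwards.\<close>
      have "\<not> x ?a < x0"
      proof
        assume "x ?a < x0"
        from velocity_after_zero(1)[OF a this] obtain d where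
          d: "d > 0" "\<And>h. h > 0 \<Longrightarrow> h < d \<Longrightarrow> vel (?a - h) < 0" by blast
        define h where "h = min d g / 2"
        have "h > 0" "h < d" "h < g" using d g by (auto simp: h_def)
        then show False using d(2)[of h] Suc.IH[rule_format, of "?a - h"] True by (auto simp: g_def)
      qed
      then have "x ?a > x0" using velocity_zero_deriv(3)[OF a] by blast
      from velocity_after_zero(2)[OF a this] obtain d where
        d: "d > 0" "\<And>h. h > 0 \<Longrightarrow> h < d \<Longrightarrow> vel (?a + h) < 0" by blast
      define h where "h = min d g / 2"
      have h: "h > 0" "h < d" "h < g" using d g by (auto simp: h_def)
      have "\<not> vel t > 0" if "?a < t" "t < T (Suc (Suc i))" for t
        using const[of "Suc i" t "?a + h"] that h d(2)[of h] by (auto simp: g_def)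
      then show ?thesis using True nz[of "Suc i"] by (auto simp: not_less le_less)
    next
      case False
      have "\<not> x ?a > x0"
      proof
        assume "x ?a > x0"
        from velocity_after_zero(2)[OF a this] obtain d where
          d: "d > 0" "\<And>h. h > 0 \<Longrightarrow> h < d \<Longrightarrow> vel (?a - h) > 0" by blast
        define h where "h = min d g / 2"
        have "h > 0" "h < d" "h < g" using d g by (auto simp: h_def)
        then show False using d(2)[of h] Suc.IH[rule_format, of "?a - h"] False by (auto simp: g_def)
      qed
      then have "x ?a < x0" using velocity_zero_deriv(3)[OF a] by blast
      from velocity_after_zero(1)[OF a this] obtain d where
        d: "d > 0" "\<And>h. h > 0 \<Longrightarrow> h < d \<Longrightarrow> vel (?a + h) > 0" by blast
      define h where "h = min d g / 2"
      have h: "h > 0" "h < d" "h < g" using d g by (auto simp: h_def)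
      have "vel t > 0" if "?a < t" "t < T (Suc (Suc i))" for t
        using const[of "Suc i" "?a + h" t] that h d(2)[of h] by (auto simp: g_def)
      then show ?thesis using False by auto
    qed
  qed
  have side: "if even i then x (T i) < x0 else x0 < x (T i)" if "i \<ge> 1" for i
  proof -
    have a: "vel (T i) = 0" by (rule zero[OF that])
    define g where "g = T (Suc i) - T i"
    have g: "g > 0" using mono by (simp add: strict_mono_Suc_iff g_def)
    show ?thesis
    proof (cases "even i")
      case True
      have "\<not> x (T i) > x0"
      proof
        assume "x (T i) > x0"
        from velocity_after_zero(2)[OF a this] obtain d where
          d: "d > 0" "\<And>h. h > 0 \<Longrightarrow> h < d \<Longrightarrow> vel (T i + h) < 0" by blast
        define h where "h = min d g / 2"
        have "h > 0" "h < d" "h < g" using d g by (auto simp: h_def)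
        then show False using d(2)[of h] sign[rule_format, of i "T i + h"] True by (auto simp: g_def)
      qed
      then show ?thesis using True velocity_zero_deriv(3)[OF a] by auto
    next
      case False
      have "\<not> x (T i) < x0"
      proof
        assume "x (T i) < x0"
        from velocity_after_zero(1)[OF a this] obtain d where
          d: "d > 0" "\<And>h. h > 0 \<Longrightarrow> h < d \<Longrightarrow> vel (T i + h) > 0" by blast
        define h where "h = min d g / 2"
        have "h > 0" "h < d" "h < g" using d g by (auto simp: h_def)
        then show False using d(2)[of h] sign[rule_format, of i "T i + h"] False by (auto simp: g_def)
      qed
      then show ?thesis using False velocity_zero_deriv(3)[OF a] by auto
    qed
  qed
  \<comment> \<open>A finite limit of the turning times would be an accumulation point of zeros,
    against their isolation.\<close>
  have unbounded: "\<exists>i. T i > B" for B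
  proof (rule ccontr)
    assume "\<not> (\<exists>i. T i > B)"
    then have "T i \<le> B" for i by (simp add: not_less)
    then obtain L where L: "T \<longlonglongrightarrow> L" "\<And>i. T i \<le> L"
      using incseq_convergent[OF strict_mono_mono[OF mono], of B] by blast
    have below: "T i < L" for i
      using L(2)[of "Suc i"] mono by (metis less_le_trans lessI strict_monoD)
    obtain d where d: "d > 0" "\<And>s. s \<noteq> L \<Longrightarrow> \<bar>s - L\<bar> < d \<Longrightarrow> vel s \<noteq> 0"
      using velocity_zeros_isolated by metis
    have "\<forall>\<^sub>F i in sequentially. dist (T i) L < d \<and> i \<ge> 1"
      using tendstoD[OF L(1) d(1)] eventually_ge_at_top[of 1] by eventually_elim simp
    then obtain i where "dist (T i) L < d" "i \<ge> 1" by (auto dest!: eventually_happens)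
    then show False using d(2)[of "T i"] below[of i] zero[of i] by (auto simp: dist_real_def)
  qed
  have "filterlim T at_top sequentially"
    unfolding filterlim_at_top
  proof
    fix Z
    obtain i where i: "T i > Z" using unbounded by blast
    have "T j \<ge> Z" if "j \<ge> i" for j
      using i strict_mono_less_eq[OF mono, of i j] that by simp
    then show "\<forall>\<^sub>F j in sequentially. Z \<le> T j" by (auto simp: eventually_sequentially)
  qed
  then show thesis using that[of T] mono T0 zero sign side by blast
qed

text \<open>The indices i and i + 2 lie on the same side of \<open>x0\<close>, where
  \<open>rest_energy\<close> is strictly monotone, so the gain in energy reads as an approach to
  \<open>x0\<close>.\<close>

lemma turning_points_approach:
  assumes "strict_mono T" and "\<And>i. i \<ge> 1 \<Longrightarrow> vel (T i) = 0"
    and "\<And>i t. T i < t \<Longrightarrow> t < T (Suc i) \<Longrightarrow> if even i then vel t > 0 else vel t < 0"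
    and side: "\<And>i. i \<ge> 1 \<Longrightarrow> if even i then x (T i) < x0 else x0 < x (T i)"
    and i: "i \<ge> 1"
  shows "even i \<Longrightarrow> x (T i) < x (T (i + 2))" and "odd i \<Longrightarrow> x (T (i + 2)) < x (T i)"
proof -
  have step: "en (T j) < en (T (Suc j))" for j
  proof (rule en_strict_mono)
    show "T j < T (Suc j)" using assms(1) by (simp add: strict_mono_Suc_iff)
    show "vel u \<noteq> 0" if "T j < u" "u < T (Suc j)" for u
      using assms(3)[OF that] by (auto split: if_splits)
  qed
  have "rest_energy (x (T i)) < rest_energy (x (T (i + 2)))"
    using less_trans[OF step step, of i] en_at_rest[OF assms(2)[of i]] en_at_rest[OF assms(2)[of "i + 2"]] i
    by simp
  then show "x (T i) < x (T (i + 2))" if "even i"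
    using rest_energy_increasing[of "x (T (i + 2))" "x (T i)"] side[OF i] that x_pos[of "T (i + 2)"]
    by (cases "x (T i)" "x (T (i + 2))" rule: linorder_cases) auto
  show "x (T (i + 2)) < x (T i)" if "odd i"
    using \<open>rest_energy (x (T i)) < _\<close> rest_energy_decreasing[of "x (T i)" "x (T (i + 2))"] side[OF i] that
    by (cases "x (T i)" "x (T (i + 2))" rule: linorder_cases) auto
qed

end

section \<open>Smoothness and conclusion\<close>

text \<open>The algebra generated along the orbit by x, w and 1 / (1 + \<mu> x^2). Since the vector
  field is polynomial in these three, the algebra is closed under differentiation, which yields
  derivatives of every order.\<close>

inductive rational_along :: "real \<Rightarrow> (real \<Rightarrow> real) \<Rightarrow> (real \<Rightarrow> real) \<Rightarrow> (real \<Rightarrow> real) \<Rightarrow> bool"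
  for \<mu> x w where
  const: "rational_along \<mu> x w (\<lambda>_. c)"
| fst: "rational_along \<mu> x w x"
| snd: "rational_along \<mu> x w w"
| recip: "rational_along \<mu> x w (\<lambda>t. 1 / (1 + \<mu> * (x t)\<^sup>2))"
| add: "rational_along \<mu> x w f \<Longrightarrow> rational_along \<mu> x w g \<Longrightarrow> rational_along \<mu> x w (\<lambda>t. f t + g t)"
| mult: "rational_along \<mu> x w f \<Longrightarrow> rational_along \<mu> x w g \<Longrightarrow> rational_along \<mu> x w (\<lambda>t. f t * g t)"

text \<open>If \<open>S\<close> is closed under differentiation, every iterated vector derivative of
  the pair is again a pair of members of \<open>S\<close>, hence differentiable.\<close>

lemma smooth_curve_PairI:
  fixes f g :: "real \<Rightarrow> real"
  assumes closed: "\<And>f. S f \<Longrightarrow> \<exists>f'. S f' \<and> (\<forall>t. (f has_real_derivative f' t) (at t))"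
    and "S f" "S g"
  shows "smooth_curve (\<lambda>t. (f t, g t))"
proof -
  have step: "\<exists>a' b'. S a' \<and> S b' \<and> (\<forall>t. ((\<lambda>t. (a t, b t)) has_vector_derivative (a' t, b' t)) (at t))"
    if ab: "S a" "S b" for a b
  proof -
    obtain a' where "S a'" "\<And>t. (a has_real_derivative a' t) (at t)" using closed[OF ab(1)] by blast
    moreover obtain b' where "S b'" "\<And>t. (b has_real_derivative b' t) (at t)" using closed[OF ab(2)] by blast
    ultimately have "S a' \<and> S b' \<and> (\<forall>t. ((\<lambda>t. (a t, b t)) has_vector_derivative (a' t, b' t)) (at t))"
      by (simp add: has_vector_derivative_Pair has_real_derivative_iff_has_vector_derivative)
    then show ?thesis by blast
  qed
  have iterate: "\<exists>a b. S a \<and> S b \<and> ((\<lambda>h s. vector_derivative h (at s)) ^^ m) (\<lambda>t. (f t, g t)) = (\<lambda>t. (a t, b t))" for m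
  proof (induction m)
    case 0
    then show ?case using assms by auto
  next
    case (Suc m)
    then obtain a b where ab: "S a" "S b"
      "((\<lambda>h s. vector_derivative h (at s)) ^^ m) (\<lambda>t. (f t, g t)) = (\<lambda>t. (a t, b t))" by blast
    obtain a' b' where "S a'" "S b'" "\<And>t. ((\<lambda>t. (a t, b t)) has_vector_derivative (a' t, b' t)) (at t)"
      using step[OF ab(1,2)] by blast
    then show ?case by (intro exI[of _ a'] exI[of _ b']) (auto simp: ab(3) vector_derivative_at)
  qed
  show ?thesis
    unfolding smooth_curve_def
  proof (intro allI)
    fix m t
    obtain a b where "S a" "S b"
      and eq: "((\<lambda>h s. vector_derivative h (at s)) ^^ m) (\<lambda>t. (f t, g t)) = (\<lambda>t. (a t, b t))"
      using iterate by blast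
    then show "((\<lambda>h s. vector_derivative h (at s)) ^^ m) (\<lambda>t. (f t, g t)) differentiable (at t)"
      unfolding eq using step differentiableI_vector by blast
  qed
qed

context cone_orbit
begin

lemma rational_along_deriv:
  assumes "rational_along \<mu> x w f"
  shows "\<exists>f'. rational_along \<mu> x w f' \<and> (\<forall>t. (f has_real_derivative f' t) (at t))"
  using assms
proof induction
  case (const c)
  show ?case by (intro exI[of _ "\<lambda>_. 0"]) (auto intro: rational_along.const)
next
  case fst
  have "rational_along \<mu> x w (\<lambda>t. w t + (- 1) * x t)" by (intro rational_along.intros)
  then show ?case using dx by auto
next
  case snd
  let ?I = "\<lambda>t. 1 / (1 + \<mu> * (x t)\<^sup>2)"
  have "rational_along \<mu> x w
      (\<lambda>t. (- 1 + (- 1) * (w t * w t)) * ((1 + real p * ?I t) * w t + (- bnd) * (x t * ?I t)))"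
    by (intro rational_along.intros)
  moreover have acc: "accel (x t) (w t)
      = (- 1 + (- 1) * (w t * w t)) * ((1 + real p * ?I t) * w t + (- bnd) * (x t * ?I t))" for t
    by (simp add: accel_def bnd_def power2_eq_square)
  ultimately show ?case using dw[unfolded acc] by blast
next
  case recip
  let ?I = "\<lambda>t. 1 / (1 + \<mu> * (x t)\<^sup>2)"
  have "rational_along \<mu> x w (\<lambda>t. (- 2 * \<mu>) * (x t * (w t + (- 1) * x t)) * (?I t * ?I t))"
    by (intro rational_along.intros)
  moreover have "(?I has_real_derivative (- 2 * \<mu>) * (x t * (w t + (- 1) * x t)) * (?I t * ?I t)) (at t)" for t
    using denom_pos(3)[of "x t"]
    by (auto intro!: derivative_eq_intros dx simp: field_simps)
  ultimately show ?case by blast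
next
  case (add f g)
  then obtain f' g' where "rational_along \<mu> x w f'" "rational_along \<mu> x w g'"
    "\<And>t. (f has_real_derivative f' t) (at t)" "\<And>t. (g has_real_derivative g' t) (at t)" by blast
  then show ?case
    by (intro exI[of _ "\<lambda>t. f' t + g' t"]) (auto intro!: rational_along.intros DERIV_add)
next
  case (mult f g)
  then obtain f' g' where "rational_along \<mu> x w f'" "rational_along \<mu> x w g'"
    "\<And>t. (f has_real_derivative f' t) (at t)" "\<And>t. (g has_real_derivative g' t) (at t)" by blast
  with mult.hyps show ?case
    by (intro exI[of _ "\<lambda>t. f' t * g t + g' t * f t"]) (auto intro!: rational_along.intros DERIV_mult)
qed

lemma smooth_orbit: "smooth_curve (\<lambda>t. (x t, vel t))"
proof (rule smooth_curve_PairI[where S = "rational_along \<mu> x w", OF rational_along_deriv])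
  have "rational_along \<mu> x w (\<lambda>t. w t + (- 1) * x t)" by (intro rational_along.intros)
  then show "rational_along \<mu> x w vel" by (simp add: vel_def[abs_def])
qed (auto intro: rational_along.intros)

end

section \<open>Subsequences of odd and even index, and the conclusion\<close>

lemma strict_antimono_on_odd:
  fixes a :: "nat \<Rightarrow> real"
  assumes "\<And>i. odd i \<Longrightarrow> a (i + 2) < a i"
  shows "strict_antimono_on {1..} (\<lambda>m. a (2 * m - 1))"
proof (rule monotone_onI)
  fix m n :: nat assume "m \<in> {1..}" "n \<in> {1..}" "m < n"
  have "- a (2 * i + 1) < - a (2 * Suc i + 1)" for i using assms[of "2 * i + 1"] by simp
  from lift_Suc_mono_less[of "\<lambda>i. - a (2 * i + 1)", OF this, of "m - 1" "n - 1"]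
  have "a (2 * (n - 1) + 1) < a (2 * (m - 1) + 1)" using \<open>m \<in> _\<close> \<open>m < n\<close> by auto
  moreover have "2 * (n - 1) + 1 = 2 * n - 1" "2 * (m - 1) + 1 = 2 * m - 1"
    using \<open>m \<in> _\<close> \<open>n \<in> _\<close> by auto
  ultimately show "a (2 * n - 1) < a (2 * m - 1)" by simp
qed

lemma strict_mono_on_even:
  fixes a :: "nat \<Rightarrow> real"
  assumes "\<And>i. even i \<Longrightarrow> i \<ge> 1 \<Longrightarrow> a i < a (i + 2)"
  shows "strict_mono_on {1..} (\<lambda>m. a (2 * m))"
proof (rule monotone_onI)
  fix m n :: nat assume "m \<in> {1..}" "n \<in> {1..}" "m < n"
  have "a (2 * Suc i) < a (2 * Suc (Suc i))" for i using assms[of "2 * Suc i"] by simp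
  moreover have "m - 1 < n - 1" using \<open>m \<in> _\<close> \<open>m < n\<close> by auto
  ultimately have "a (2 * Suc (m - 1)) < a (2 * Suc (n - 1))" by (rule lift_Suc_mono_less)
  moreover have "Suc (n - 1) = n" "Suc (m - 1) = m" using \<open>m \<in> _\<close> \<open>n \<in> _\<close> by auto
  ultimately show "a (2 * m) < a (2 * n)" by simp
qed

theorem proposition3p4:
  fixes k :: int and n p :: nat and lam \<phi>\<^sub>0 :: real
  assumes "even k"
    and "(n, p) = (3, 2) \<and> k \<ge> 4 \<or> (n, p) = (5, 4) \<and> k \<ge> 6"
    and "lam\<^sup>2 = real_of_int k * (real_of_int k + real n - 1) / real p"
    and "\<phi>\<^sub>0 = sqrt ((real p - real n / lam\<^sup>2) / (real n - real p))"
  shows "\<exists>(\<phi> :: real \<Rightarrow> real) (\<psi> :: real \<Rightarrow> real) (T :: nat \<Rightarrow> real).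
      smooth_curve (\<lambda>t. (\<phi> t, \<psi> t)) \<and>
      (\<forall>t. (\<phi> has_real_derivative \<psi> t) (at t)) \<and>
      (\<forall>t. (\<psi> has_real_derivative
          (- \<psi> t
           - ((real n - real p + real p / (1 + lam\<^sup>2 * (\<phi> t)\<^sup>2)) * \<psi> t
              + (real n - real p + (1 - lam\<^sup>2) * real p / (1 + lam\<^sup>2 * (\<phi> t)\<^sup>2)) * \<phi> t)
             * (1 + (\<phi> t + \<psi> t)\<^sup>2))) (at t)) \<and>
      strict_mono_on {1..} T \<and>
      ((\<lambda>t. (\<phi> t, \<psi> t)) \<longlongrightarrow> (0, 0)) at_bot \<and>
      \<phi> \<in> O[at_bot](\<lambda>t. exp ((real_of_int k - 1) * t)) \<and>
      \<psi> \<in> O[at_bot](\<lambda>t. exp ((real_of_int k - 1) * t)) \<and>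
      ((\<lambda>t. (\<phi> t, \<psi> t)) \<longlongrightarrow> (\<phi>\<^sub>0, 0)) at_top \<and>
      filterlim T at_top sequentially \<and>
      (\<forall>i\<ge>1. \<psi> (T i) = 0) \<and>
      strict_antimono_on {1..} (\<lambda>m. \<phi> (T (2 * m - 1))) \<and>
      strict_mono_on {1..} (\<lambda>m. \<phi> (T (2 * m))) \<and>
      (\<lambda>m. \<phi> (T (2 * m - 1))) \<longlonglongrightarrow> \<phi>\<^sub>0 \<and>
      (\<lambda>m. \<phi> (T (2 * m))) \<longlonglongrightarrow> \<phi>\<^sub>0 \<and>
      (\<forall>t \<in> {..<T 1} \<union> (\<Union>m\<in>{1..}. {T (2 * m)<..<T (2 * m + 1)}). \<psi> t > 0) \<and>
      (\<forall>t \<in> (\<Union>m\<in>{1..}. {T (2 * m - 1)<..<T (2 * m)}). \<psi> t < 0) \<and>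
      (\<forall>t. \<phi> t + \<psi> t > 0)"
proof -
  define k' where "k' = nat k"
  define \<mu> where "\<mu> = lam\<^sup>2"
  have k: "real_of_int k = real k'" and k4: "k' \<ge> 4" and p: "p = 2 \<or> p = 4 \<and> k' \<ge> 6" and n: "real n = real p + 1"
    using assms(2) by (auto simp: k'_def)
  have mu: "real p * \<mu> = real k' * (real k' + real p)"
    using assms(3) p by (auto simp: \<mu>_def k n)
  interpret cone_ode k' p \<mu>
    by unfold_locales (use k4 p mu in auto)
  obtain x w :: "real \<Rightarrow> real" and t0 where
    ode: "\<And>t. (x has_real_derivative w t - x t) (at t)"
      "\<And>t. (w has_real_derivative accel (x t) (w t)) (at t)"
    and bounds: "\<And>t. 0 < x t" "\<And>t. x t < bnd" "\<And>t. 0 < w t" "\<And>t. w t < bnd"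
    and early: "\<And>t. t \<le> t0 \<Longrightarrow> x t < w t"
    and decay: "\<And>t. t \<le> 0 \<Longrightarrow> x t < bnd * exp (real (k' - 1) * t)"
      "\<And>t. t \<le> 0 \<Longrightarrow> w t < bnd * exp (real (k' - 1) * t)"
    by (rule solution_exists) (rule that; assumption)
  have null: "(f \<longlongrightarrow> 0) at_bot"
    if small: "\<And>t. t \<le> 0 \<Longrightarrow> f t < bnd * exp (real (k' - 1) * t)" and pos: "\<And>t. 0 < f t" for f :: "real \<Rightarrow> real"
  proof (rule Lim_null_comparison)
    have "norm (f t) \<le> bnd * exp t" if t: "t \<le> 0" for t
    proof -
      have "real (k' - 1) * t \<le> 1 * t" using t k4 by (intro mult_right_mono_neg) auto
      then have "bnd * exp (real (k' - 1) * t) \<le> bnd * exp t" using bnd_pos by simp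
      then show ?thesis using small[OF t] pos[of t] by simp
    qed
    then show "\<forall>\<^sub>F t in at_bot. norm (f t) \<le> bnd * exp t"
      unfolding eventually_at_bot_linorder by blast
    show "((\<lambda>t. bnd * exp t) \<longlongrightarrow> 0) at_bot"
      using tendsto_mult[OF tendsto_const exp_at_bot, of bnd] by simp
  qed
  \<comment> \<open>With b = \<open>bnd\<close> this is b > 9 for p = 2, where b >= 24, and b > 50
    for p = 4, where k >= 6 gives b >= 60; k = 5 would only give 45.\<close>
  have "(real p + 2)\<^sup>2 * bnd < 8 * (real p + 1) * (bnd - (real p + 1))"
  proof -
    have "bnd = real k' * (real k' + real p)" by (simp add: bnd_def mu)
    moreover have "real k' * (real k' + real p) \<ge> 4 * (4 + 2)" if "p = 2"
      using k4 that by (intro mult_mono) auto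
    moreover have "real k' * (real k' + real p) \<ge> 6 * (6 + 4)" if "p = 4" "k' \<ge> 6"
      using that by (intro mult_mono) auto
    ultimately show ?thesis using p by auto
  qed
  then interpret cone_orbit k' p \<mu> x w t0
    by unfold_locales (use ode bounds early null decay in auto)
  obtain T :: "nat \<Rightarrow> real" where T: "strict_mono T" and T0: "T 0 = t0"
    and zero: "\<And>i. i \<ge> 1 \<Longrightarrow> vel (T i) = 0"
    and sign: "\<And>i t. T i < t \<Longrightarrow> t < T (Suc i) \<Longrightarrow> if even i then vel t > 0 else vel t < 0"
    and side: "\<And>i. i \<ge> 1 \<Longrightarrow> if even i then x (T i) < x0 else x0 < x (T i)"
    and T_top: "filterlim T at_top sequentially"
    by (rule turning_times) (rule that; assumption)
  note approach = turning_points_approach[OF T zero sign side]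
  have \<phi>0: "\<phi>\<^sub>0 = x0"
    unfolding x0_def unfolding \<mu>_def using assms(4) by (simp add: n)
  have rhs: "- vel t - ((real n - real p + real p / (1 + lam\<^sup>2 * (x t)\<^sup>2)) * vel t
        + (real n - real p + (1 - lam\<^sup>2) * real p / (1 + lam\<^sup>2 * (x t)\<^sup>2)) * x t) * (1 + (x t + vel t)\<^sup>2)
      = - dmp t * vel t + stf t * (x0 - x t)" for t
  proof -
    define D where "D = 1 + \<mu> * (x t)\<^sup>2"
    have D: "D \<noteq> 0" using denom_pos(3) by (simp add: D_def)
    define G where "G = (1 + real p / D) * w t - real p * \<mu> * x t / D"
    have G: "(1 + real p / D) * vel t + (1 + (1 - \<mu>) * real p / D) * x t = G"
      using D by (simp add: G_def vel_def field_simps)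
    have "- dmp t * vel t + stf t * (x0 - x t) = - (1 + (w t)\<^sup>2) * G - vel t"
      unfolding dmp_def stf_def vel_def accel_oscillator[symmetric] accel_def G_def D_def ..
    moreover have "real n - real p = 1" "x t + vel t = w t" by (simp_all add: n vel_def)
    ultimately show ?thesis
      unfolding \<mu>_def[symmetric] D_def[symmetric] by (simp only: G) (simp add: algebra_simps)
  qed
  have bigo: "f \<in> O[at_bot](\<lambda>t. exp ((real_of_int k - 1) * t))"
    if "\<And>t. t \<le> 0 \<Longrightarrow> \<bar>f t\<bar> \<le> bnd * exp (real (k' - 1) * t)" for f :: "real \<Rightarrow> real"
  proof (rule bigoI)
    show "\<forall>\<^sub>F t in at_bot. norm (f t) \<le> bnd * norm (exp ((real_of_int k - 1) * t))"
      unfolding eventually_at_bot_linorder using that k4 by (intro exI[of _ 0]) (simp add: k of_nat_diff)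
  qed
  show ?thesis
  proof (intro exI conjI)
    show "smooth_curve (\<lambda>t. (x t, vel t))" by (rule smooth_orbit)
    show "\<forall>t. (x has_real_derivative vel t) (at t)" using x_deriv_vel by blast
    show "\<forall>t. (vel has_real_derivative
          (- vel t
           - ((real n - real p + real p / (1 + lam\<^sup>2 * (x t)\<^sup>2)) * vel t
              + (real n - real p + (1 - lam\<^sup>2) * real p / (1 + lam\<^sup>2 * (x t)\<^sup>2)) * x t)
             * (1 + (x t + vel t)\<^sup>2))) (at t)"
      unfolding rhs using vel_deriv by blast
    show "strict_mono_on {1..} T" using T by (auto simp: monotone_on_def)
    have "(vel \<longlongrightarrow> 0 - 0) at_bot" unfolding vel_def[abs_def] by (intro tendsto_diff x_lim w_lim)
    then show "((\<lambda>t. (x t, vel t)) \<longlongrightarrow> (0, 0)) at_bot" using x_lim by (auto intro: tendsto_Pair)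
    show "x \<in> O[at_bot](\<lambda>t. exp ((real_of_int k - 1) * t))"
      by (rule bigo) (use decay(1) x_pos in \<open>auto simp: less_imp_le abs_of_pos\<close>)
    show "vel \<in> O[at_bot](\<lambda>t. exp ((real_of_int k - 1) * t))"
    proof (rule bigo)
      fix t :: real assume "t \<le> 0"
      then show "\<bar>vel t\<bar> \<le> bnd * exp (real (k' - 1) * t)"
        using decay[of t] x_pos[of t] w_pos[of t] unfolding vel_def by linarith
    qed
    show "((\<lambda>t. (x t, vel t)) \<longlongrightarrow> (\<phi>\<^sub>0, 0)) at_top"
      unfolding \<phi>0 by (intro tendsto_Pair x_tendsto vel_tendsto_0)
    show "filterlim T at_top sequentially" by (rule T_top)
    show "\<forall>i\<ge>1. vel (T i) = 0" using zero by blast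
    show "strict_antimono_on {1..} (\<lambda>m. x (T (2 * m - 1)))"
      using strict_antimono_on_odd[of "\<lambda>i. x (T i)"] approach(2) odd_pos by (metis One_nat_def Suc_leI)
    show "strict_mono_on {1..} (\<lambda>m. x (T (2 * m)))"
      using strict_mono_on_even[of "\<lambda>i. x (T i)"] approach(1) by blast
    have lim: "(\<lambda>i. x (T i)) \<longlonglongrightarrow> \<phi>\<^sub>0" unfolding \<phi>0 by (rule filterlim_compose[OF x_tendsto T_top])
    \<comment> \<open>Natural subtraction sends m = 0 to index 0, which the limit ignores; from m =
      1 on, m <= 2 m - 1.\<close>
    show "(\<lambda>m. x (T (2 * m - 1))) \<longlonglongrightarrow> \<phi>\<^sub>0"
    proof (rule filterlim_compose[OF lim])
      show "filterlim (\<lambda>m. 2 * m - 1 :: nat) sequentially sequentially"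
        by (rule filterlim_at_top_mono[OF filterlim_ident]) (auto simp: eventually_sequentially intro!: exI[of _ 1])
    qed
    show "(\<lambda>m. x (T (2 * m))) \<longlonglongrightarrow> \<phi>\<^sub>0"
    proof (rule filterlim_compose[OF lim])
      show "filterlim (\<lambda>m. 2 * m :: nat) sequentially sequentially"
        by (rule filterlim_at_top_mono[OF filterlim_ident]) auto
    qed
    show "\<forall>t \<in> {..<T 1} \<union> (\<Union>m\<in>{1..}. {T (2 * m)<..<T (2 * m + 1)}). vel t > 0"
    proof (intro ballI, elim UnE UN_E)
      fix t assume "t \<in> {..<T 1}"
      \<comment> \<open>The unbounded first interval is the initial phase up to
        \<open>T 0 = t0\<close> followed by the interval of index 0.\<close>
      then show "vel t > 0" using sign[of 0 t] early[of t] T0 by (cases "t \<le> t0") (auto simp: vel_def)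
    next
      fix t m assume "t \<in> {T (2 * m)<..<T (2 * m + 1)}"
      then show "vel t > 0" using sign[of "2 * m" t] by simp
    qed
    show "\<forall>t \<in> (\<Union>m\<in>{1..}. {T (2 * m - 1)<..<T (2 * m)}). vel t < 0"
    proof (intro ballI, elim UN_E)
      fix t and m :: nat assume m: "m \<in> {1..}" "t \<in> {T (2 * m - 1)<..<T (2 * m)}"
      then have "Suc (2 * m - 1) = 2 * m" "odd (2 * m - 1)" by auto
      then show "vel t < 0" using sign[of "2 * m - 1" t] m by simp
    qed
    show "\<forall>t. x t + vel t > 0" using w_pos by (simp add: vel_def)
  qed
qed

end
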